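(* Let $d\ge1$ be an integer, $\delta\in(0,1)$, $\beta>0$, $R>0$ and $\rho\in[0,1]$. Let $\psi$ be a probability distribution on $\mathbb R$ with zero mean and unit variance which admits a density $f$ such that $$\kappa=\sup_{v\ne0}v^{-2}\int f(u)\log\frac{f(u)}{f(u+v)}\,du<\infty.$$ For $T\ge 1$, let $\overline M_T(\psi,\beta,R,\delta,\rho)$ be the reduced minimax prediction risk for time varying autoregressive processes of order $d$ with normalized innovations of distribution $\psi$, as defined in the context. Then $$\liminf_{T\to\infty}T^{2\beta/(1+2\beta)}\,\overline M_T(\psi,\beta,R,\delta,\rho)>0.$$
   Context: Hölder balls. $|\cdot|$ is the Euclidean norm. For $\beta\in(0,1]$ and an interval $I\subseteq\mathbb R$, $|\mathbf f|_\beta=\sup_{0<|s-s'|<1}|\mathbf f(s)-\mathbf f(s')|/|s-s'|^\beta$ for $\mathbf f:I\to\mathbb R^d$ (with $s,s'\in I$). For general $\beta>0$ write $\beta=k+\alpha$ with $k\in\mathbb N$, $\alpha\in(0,1]$; set $|\mathbf f|_\beta=|\mathbf f^{(k)}|_\alpha$ if $\mathbf f$ is $k$ times differentiable on $I$, and $|\mathbf f|_\beta=\infty$ otherwise. $\Lambda_d(\beta,R)=\{\mathbf f:(-\infty,1]\to\mathbb R^d:\ |\mathbf f|_\beta\le R\}$. Stability. For $\boldsymbol\theta=(\theta_1,\dots,\theta_d):(-\infty,1]\to\mathbb R^d$ let $\boldsymbol\theta(z;u)=1-\sum_{j=1}^d\theta_j(u)z^j$. For $\delta\in(0,1)$, $s_d(\delta)$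 is the set of $\boldsymbol\theta:(-\infty,1]\to\mathbb R^d$ such that $\boldsymbol\theta(z;u)\ne0$ for all complex $z$ with $|z|<\delta^{-1}$ and all $u\in(-\infty,1]$. Parameter class. For $\beta,R,\sigma_+>0$, $\delta\in(0,1)$, $\rho\in[0,1]$: $\mathcal C(\beta,R,\delta,\rho,\sigma_+)$ is the set of $(\boldsymbol\theta,\sigma):(-\infty,1]\to\mathbb R^d\times[\rho\sigma_+,\sigma_+]$ with $\boldsymbol\theta\in\Lambda_d(\beta,R)\cap s_d(\delta)$. TVAR process. Given i.i.d. $(\xi_t)_{t\in\mathbb Z}$ with zero mean, unit variance and distribution $\psi$, a TVAR process with parameters $(\boldsymbol\theta,\sigma)$ sampled at frequency $T^{-1}$ is a process $(X_{t,T})_{t\le T}$ with $X_{t,T}=\sum_{j=1}^d\theta_j(\frac{t-1}T)X_{t-j,T}+\sigma(\frac tT)\xi_t$ for all $-\infty<t\le T$, and $\lim_{M\to\infty}\sup_{-\infty<t\le T}\mathbb P(|X_{t,T}|>M)=0$. For $(\boldsymbol\theta,\sigma)\in\mathcal C(\beta,R,\delta,\rho,\sigma_+)$ such a process exists and is unique for all $T$ large enough (uniformly over the class); $\mathbb E^\psi_{(\boldsymbol\theta,\sigma)}$ denotes expectation under its law. Predictors. $\mathcal P_T$ is the set of sequences $\widehat X_T=(\widehat X_{t,T})_{1\le t\le T}$ such that each $\widehat X_{t,T}$ is measurable with respect to $\sigma(X_{s,T},\,s\le t-1)$ (i.e. is a measurable function of the past, not depending on the unknown parameter $(\boldsymbol\theta,\sigma)$).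 Risks. The maximal risk is $$S_T(\widehat X_T;\psi,\beta,R,\delta,\rho,\sigma_+)=\sup_{(\boldsymbol\theta,\sigma)\in\mathcal C(\beta,R,\delta,\rho,\sigma_+)}\frac1T\sum_{t=1}^T\Big(\mathbb E^\psi_{(\boldsymbol\theta,\sigma)}\big[(\widehat X_{t,T}-X_{t,T})^2\big]-\sigma^2(\tfrac tT)\Big),$$ and the reduced minimax risk is $\overline M_T(\psi,\beta,R,\delta,\rho)=\inf_{\widehat X_T\in\mathcal P_T}S_T(\widehat X_T;\psi,\beta,R,\delta,\rho,1)$. *)

theory Defs
  imports "HOL-Probability.Probability"
begin

text \<open>
  Vectors of \<open>\<real>\<^sup>d\<close> are functions \<open>nat \<Rightarrow> real\<close> of which only the coordinates \<open>1, \<dots>, d\<close> matter, so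
  that \<open>L2_set v {1..d}\<close> is the Euclidean norm.  A function on \<open>(-\<infinity>,1]\<close> is a total function of
  which only the values on \<open>{..1}\<close> are used.
\<close>

section \<open>Hoelder balls\<close>

text \<open>Derivatives are taken within \<open>I\<close>, hence one-sided at an endpoint that belongs to \<open>I\<close>.\<close>

primrec nderiv_on :: "real set \<Rightarrow> nat \<Rightarrow> (real \<Rightarrow> real) \<Rightarrow> real \<Rightarrow> real" where
  "nderiv_on I 0 f = f"
| "nderiv_on I (Suc k) f = (\<lambda>s. vector_derivative (nderiv_on I k f) (at s within I))"

definition times_differentiable_on :: "nat \<Rightarrow> (real \<Rightarrow> real) \<Rightarrow> real set \<Rightarrow> bool" where
  "times_differentiable_on k f I \<longleftrightarrow> (\<forall>i<k. nderiv_on I i f differentiable_on I)"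

definition holder_seminorm_le1 :: "nat \<Rightarrow> real set \<Rightarrow> real \<Rightarrow> (real \<Rightarrow> nat \<Rightarrow> real) \<Rightarrow> ennreal" where
  "holder_seminorm_le1 d I \<alpha> f =
     (SUP (s, s') \<in> {(s, s'). s \<in> I \<and> s' \<in> I \<and> 0 < \<bar>s - s'\<bar> \<and> \<bar>s - s'\<bar> < 1}.
        ennreal (L2_set (\<lambda>j. f s j - f s' j) {1..d} / \<bar>s - s'\<bar> powr \<alpha>))"

text \<open>
  For \<open>\<beta> > 0\<close> the decomposition \<open>\<beta> = k + \<alpha>\<close> with \<open>k \<in> \<nat>\<close> and \<open>\<alpha> \<in> (0,1]\<close> is given by
  \<open>k = \<lceil>\<beta>\<rceil> - 1\<close>; in particular \<open>k = \<beta> - 1\<close> and \<open>\<alpha> = 1\<close> when \<open>\<beta>\<close> is an integer.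
\<close>

definition holder_seminorm :: "nat \<Rightarrow> real set \<Rightarrow> real \<Rightarrow> (real \<Rightarrow> nat \<Rightarrow> real) \<Rightarrow> ennreal" where
  "holder_seminorm d I \<beta> f =
     (let k = nat (\<lceil>\<beta>\<rceil> - 1); \<alpha> = \<beta> - real k in
      if \<forall>j\<in>{1..d}. times_differentiable_on k (\<lambda>s. f s j) I
      then holder_seminorm_le1 d I \<alpha> (\<lambda>s j. nderiv_on I k (\<lambda>u. f u j) s)
      else \<infinity>)"

definition holder_ball :: "nat \<Rightarrow> real \<Rightarrow> real \<Rightarrow> (real \<Rightarrow> nat \<Rightarrow> real) set" where
  "holder_ball d \<beta> R = {\<theta>. holder_seminorm d {..1} \<beta> \<theta> \<le> ennreal R}"

section \<open>Stability and the parameter class\<close>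

definition tv_poly :: "nat \<Rightarrow> (real \<Rightarrow> nat \<Rightarrow> real) \<Rightarrow> complex \<Rightarrow> real \<Rightarrow> complex" where
  "tv_poly d \<theta> z u = 1 - (\<Sum>j=1..d. complex_of_real (\<theta> u j) * z ^ j)"

definition stable_class :: "nat \<Rightarrow> real \<Rightarrow> (real \<Rightarrow> nat \<Rightarrow> real) set" where
  "stable_class d \<delta> = {\<theta>. \<forall>z. \<forall>u\<le>1. cmod z < inverse \<delta> \<longrightarrow> tv_poly d \<theta> z u \<noteq> 0}"

definition tvar_class ::
  "nat \<Rightarrow> real \<Rightarrow> real \<Rightarrow> real \<Rightarrow> real \<Rightarrow> real \<Rightarrow> ((real \<Rightarrow> nat \<Rightarrow> real) \<times> (real \<Rightarrow> real)) set" where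
  "tvar_class d \<beta> R \<delta> \<rho> \<sigma>p =
     {(\<theta>, \<sigma>). \<theta> \<in> holder_ball d \<beta> R \<inter> stable_class d \<delta> \<and> (\<forall>u\<le>1. \<sigma> u \<in> {\<rho> * \<sigma>p..\<sigma>p})}"

section \<open>TVAR processes\<close>

definition tvar_process ::
  "nat \<Rightarrow> 'w measure \<Rightarrow> (int \<Rightarrow> 'w \<Rightarrow> real) \<Rightarrow> nat \<Rightarrow> (real \<Rightarrow> nat \<Rightarrow> real) \<Rightarrow> (real \<Rightarrow> real) \<Rightarrow>
     (int \<Rightarrow> 'w \<Rightarrow> real) \<Rightarrow> bool" where
  "tvar_process d M \<xi> T \<theta> \<sigma> X \<longleftrightarrow>
     (\<forall>t\<le>int T. X t \<in> borel_measurable M) \<and>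
     (AE \<omega> in M. \<forall>t\<le>int T.
        X t \<omega> = (\<Sum>j=1..d. \<theta> (real_of_int (t - 1) / real T) j * X (t - int j) \<omega>)
                 + \<sigma> (real_of_int t / real T) * \<xi> t \<omega>) \<and>
     ((\<lambda>K. SUP t\<in>{..int T}. measure M {\<omega> \<in> space M. \<bar>X t \<omega>\<bar> > K}) \<longlongrightarrow> 0) at_top"

text \<open>
  The i.i.d. innovations are realised as the coordinates of the canonical space \<open>\<real>\<^sup>\<int>\<close> under the
  product measure.  For parameters in the class and \<open>T\<close> large, the TVAR process exists and is unique
  up to null sets, which makes the description below definite; its value for other \<open>T\<close> is
  unspecified, and irrelevant to asymptotic statements.
\<close>

definition tvar_law ::
  "nat \<Rightarrow> real measure \<Rightarrow> nat \<Rightarrow> (real \<Rightarrow> nat \<Rightarrow> real) \<Rightarrow> (real \<Rightarrow> real) \<Rightarrow> (int \<Rightarrow> real) measure" where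
  "tvar_law d \<psi> T \<theta> \<sigma> =
     (THE L. \<exists>X. tvar_process d (\<Pi>\<^sub>M t\<in>(UNIV :: int set). \<psi>) (\<lambda>t \<omega>. \<omega> t) T \<theta> \<sigma> X \<and>
        L = distr (\<Pi>\<^sub>M t\<in>(UNIV :: int set). \<psi>) (\<Pi>\<^sub>M t\<in>{..int T}. borel)
              (\<lambda>\<omega>. \<lambda>t\<in>{..int T}. X t \<omega>))"

section \<open>Predictors and risks\<close>

text \<open>
  A predictor is a family of measurable functions \<open>g t\<close> of the past \<open>(X\<^sub>s)\<close>, \<open>s \<le> t - 1\<close>; the
  predicted value is \<open>g t\<close> applied to the path restricted to \<open>{..t - 1}\<close>.
\<close>

definition predictors :: "nat \<Rightarrow> (int \<Rightarrow> (int \<Rightarrow> real) \<Rightarrow> real) set" where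
  "predictors T = {g. \<forall>t\<in>{1..int T}. g t \<in> borel_measurable (\<Pi>\<^sub>M s\<in>{..t - 1}. borel)}"

definition prediction_error ::
  "nat \<Rightarrow> real measure \<Rightarrow> nat \<Rightarrow> (real \<Rightarrow> nat \<Rightarrow> real) \<Rightarrow> (real \<Rightarrow> real) \<Rightarrow>
     (int \<Rightarrow> (int \<Rightarrow> real) \<Rightarrow> real) \<Rightarrow> int \<Rightarrow> ereal" where
  "prediction_error d \<psi> T \<theta> \<sigma> g t =
     enn2ereal (\<integral>\<^sup>+x. ennreal ((g t (restrict x {..t - 1}) - x t)\<^sup>2) \<partial>tvar_law d \<psi> T \<theta> \<sigma>)"

definition max_risk ::
  "nat \<Rightarrow> nat \<Rightarrow> (int \<Rightarrow> (int \<Rightarrow> real) \<Rightarrow> real) \<Rightarrow> real measure \<Rightarrow>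
     real \<Rightarrow> real \<Rightarrow> real \<Rightarrow> real \<Rightarrow> real \<Rightarrow> ereal" where
  "max_risk d T g \<psi> \<beta> R \<delta> \<rho> \<sigma>p =
     (SUP (\<theta>, \<sigma>) \<in> tvar_class d \<beta> R \<delta> \<rho> \<sigma>p.
        ereal (1 / real T) *
          (\<Sum>t\<in>{1..int T}. prediction_error d \<psi> T \<theta> \<sigma> g t
                            - ereal ((\<sigma> (real_of_int t / real T))\<^sup>2)))"

definition reduced_minimax_risk ::
  "nat \<Rightarrow> nat \<Rightarrow> real measure \<Rightarrow> real \<Rightarrow> real \<Rightarrow> real \<Rightarrow> real \<Rightarrow> ereal" where
  "reduced_minimax_risk d T \<psi> \<beta> R \<delta> \<rho> = (INF g \<in> predictors T. max_risk d T g \<psi> \<beta> R \<delta> \<rho> 1)"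

section \<open>The condition on the innovation density\<close>

text \<open>
  The integrand \<open>f(u) log (f(u) / f(u + v))\<close> with the usual conventions: it is \<open>0\<close> where \<open>f(u) = 0\<close>
  and \<open>\<infinity>\<close> where \<open>f(u) > 0 = f(u + v)\<close>.
\<close>

definition kl_shift_integrand :: "(real \<Rightarrow> real) \<Rightarrow> real \<Rightarrow> real \<Rightarrow> ereal" where
  "kl_shift_integrand f v u =
     (if f u = 0 then 0
      else if f (u + v) = 0 then \<infinity>
      else ereal (f u * ln (f u / f (u + v))))"

text \<open>
  The integral is the extended Lebesgue integral, positive part minus negative part.  For a
  probability density the second one is always finite, since \<open>a ln (a / b) \<ge> a - b\<close>.
\<close>

definition kl_shift :: "(real \<Rightarrow> real) \<Rightarrow> real \<Rightarrow> ereal" where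
  "kl_shift f v =
     enn2ereal (\<integral>\<^sup>+u. e2ennreal (kl_shift_integrand f v u) \<partial>lborel)
     - enn2ereal (\<integral>\<^sup>+u. e2ennreal (- kl_shift_integrand f v u) \<partial>lborel)"

definition kl_shift_const :: "(real \<Rightarrow> real) \<Rightarrow> ereal" where
  "kl_shift_const f = (SUP v\<in>{v. v \<noteq> 0}. ereal (1 / v\<^sup>2) * kl_shift f v)"

end

theory Submission
  imports Defs "HOL-Computational_Algebra.Polynomial"
begin

text \<open>
  The lower bound is already attained on first-order autoregressions with \<open>\<sigma> = 1\<close> whose coefficient
  is a superposition of bumps of height \<open>h \<approx> (q/T)\<^sup>\<beta>\<close>, each covering \<open>q \<approx> T\<^bsup>2\<beta>/(1+2\<beta>)\<^esup>\<close> consecutive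
  observation times and switched on or off independently.  With \<open>\<sigma> = 1\<close> the excess risk at time \<open>t\<close> is
  the squared distance of the predictor to \<open>\<theta>\<^sub>1((t-1)/T) X\<^bsub>t-1\<^esub>\<close>.  Flipping one bump changes the law of the
  path by a relative entropy of order \<open>\<kappa> q h\<^sup>2\<close>, which stays bounded, so no predictor can be good for
  both settings of that bump; averaging over all patterns (Assouad's argument) gives a risk of order
  \<open>h\<^sup>2 \<approx> T\<^bsup>-2\<beta>/(1+2\<beta>)\<^esup>\<close>.

  Two laws are compared on the space of innovations: replacing each innovation \<open>\<xi>\<^sub>t\<close> by
  \<open>\<xi>\<^sub>t + (a\<^sub>t - a'\<^sub>t) X\<^bsub>t-1\<^esub>\<close> turns the process with coefficients \<open>a'\<close> into the one with coefficients
  \<open>a\<close>, and this shift has an explicit likelihood ratio.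
\<close>

section \<open>Independent innovations on the canonical space\<close>

locale innovations =
  fixes \<psi> :: "real measure" and f :: "real \<Rightarrow> real"
  assumes prob_\<psi>: "prob_space \<psi>"
    and integrable_id: "integrable \<psi> (\<lambda>x. x)" and mean_\<psi>: "(\<integral>x. x \<partial>\<psi>) = 0"
    and integrable_square: "integrable \<psi> (\<lambda>x. x\<^sup>2)" and var_\<psi>: "(\<integral>x. x\<^sup>2 \<partial>\<psi>) = 1"
    and measurable_f[measurable]: "f \<in> borel_measurable borel"
    and f_nonneg: "\<And>u. 0 \<le> f u"
    and \<psi>_eq: "\<psi> = density lborel (\<lambda>u. ennreal (f u))"
begin

definition P :: "(int \<Rightarrow> real) measure" where
  "P = (\<Pi>\<^sub>M t\<in>(UNIV :: int set). \<psi>)"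

lemma sets_\<psi>[measurable_cong, simp]: "sets \<psi> = sets borel"
  by (simp add: \<psi>_eq)

lemma space_\<psi>[simp]: "space \<psi> = UNIV"
  by (simp add: \<psi>_eq)

lemma sets_P[measurable_cong]: "sets P = sets (\<Pi>\<^sub>M t\<in>(UNIV :: int set). borel)"
  unfolding P_def by (rule sets_PiM_cong) auto

lemma space_P[simp]: "space P = UNIV"
  by (simp add: P_def space_PiM)

lemma prob_P: "prob_space P"
  unfolding P_def by (intro prob_space_PiM prob_\<psi>)

lemma emeasure_\<psi>_UNIV[simp]: "emeasure \<psi> UNIV = 1"
  using prob_space.emeasure_space_1[OF prob_\<psi>] by simp

lemma emeasure_P_UNIV[simp]: "emeasure P UNIV = 1"
  using prob_space.emeasure_space_1[OF prob_P] by simp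

lemma measurable_coord[measurable]: "(\<lambda>w. w t) \<in> borel_measurable P"
  by measurable

lemma measurable_update[measurable]:
  "(\<lambda>(u, w). w(t := u)) \<in> measurable (borel \<Otimes>\<^sub>M P) P"
proof -
  have "(\<lambda>(u, w). (w :: int \<Rightarrow> real)(t := u)) \<in> measurable (borel \<Otimes>\<^sub>M PiM UNIV (\<lambda>_. borel)) (PiM UNIV (\<lambda>_. borel))"
  proof (rule measurable_PiM_single')
    fix i :: int
    show "(\<lambda>x. (case x of (u, w) \<Rightarrow> w(t := u)) i) \<in> borel_measurable (borel \<Otimes>\<^sub>M PiM UNIV (\<lambda>_. borel))"
      by (cases "i = t") (auto simp: case_prod_beta)
  qed auto
  then show ?thesis
    by measurable
qed

lemma measurable_update2[measurable (raw)]: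
  assumes [measurable]: "g \<in> borel_measurable M" "h \<in> measurable M P"
  shows "(\<lambda>x. (h x)(t := g x)) \<in> measurable M P"
proof -
  have "(\<lambda>x. (\<lambda>(u, w). w(t := u)) (g x, h x)) \<in> measurable M P"
    by (rule measurable_compose[OF _ measurable_update]) measurable
  then show ?thesis by simp
qed

text \<open>The coordinates are independent, so redrawing one of them from \<open>\<psi>\<close>
  preserves \<open>P\<close>. This replaces conditioning on the other innovations: one-step
  estimates are made in the inner integral.\<close>

lemma nn_integral_resample:
  assumes [measurable]: "F \<in> borel_measurable P"
  shows "(\<integral>\<^sup>+w. F w \<partial>P) = (\<integral>\<^sup>+w. (\<integral>\<^sup>+u. F (w(t := u)) \<partial>\<psi>) \<partial>P)"
proof -
  interpret \<psi>: prob_space \<psi> by (rule prob_\<psi>)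
  interpret P: prob_space P by (rule prob_P)
  interpret pair_sigma_finite \<psi> P ..
  have eq: "distr (\<psi> \<Otimes>\<^sub>M P) P (\<lambda>(x, X). X(t := x)) = P"
    using distr_pair_PiM_eq_PiM[of UNIV "\<lambda>_. \<psi>" t] prob_\<psi> by (simp add: P_def)
  have [measurable]: "(\<lambda>(x, X). X(t := x)) \<in> measurable (\<psi> \<Otimes>\<^sub>M P) P"
    by measurable
  have "(\<integral>\<^sup>+w. F w \<partial>P) = (\<integral>\<^sup>+w. F w \<partial>distr (\<psi> \<Otimes>\<^sub>M P) P (\<lambda>(x, X). X(t := x)))"
    by (simp add: eq)
  also have "\<dots> = (\<integral>\<^sup>+(u, w). F (w(t := u)) \<partial>(\<psi> \<Otimes>\<^sub>M P))"
    by (subst nn_integral_distr) (auto simp: case_prod_beta')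
  also have "\<dots> = (\<integral>\<^sup>+w. (\<integral>\<^sup>+u. F (w(t := u)) \<partial>\<psi>) \<partial>P)"
    by (subst nn_integral_snd[symmetric]) auto
  finally show ?thesis .
qed

lemma nn_integral_square_shift: "(\<integral>\<^sup>+u. ennreal ((y + u)\<^sup>2) \<partial>\<psi>) = ennreal (y\<^sup>2) + 1"
proof -
  interpret \<psi>: prob_space \<psi> by (rule prob_\<psi>)
  have eq: "(y + u)\<^sup>2 = y\<^sup>2 + 2 * y * u + u\<^sup>2" for u :: real
    by (simp add: power2_eq_square algebra_simps)
  have "integrable \<psi> (\<lambda>u. (y + u)\<^sup>2)"
    unfolding eq using integrable_id integrable_square by (intro Bochner_Integration.integrable_add) auto
  then have "(\<integral>\<^sup>+u. ennreal ((y + u)\<^sup>2) \<partial>\<psi>) = ennreal (\<integral>u. (y + u)\<^sup>2 \<partial>\<psi>)"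
    by (intro nn_integral_eq_integral) auto
  also have "(\<integral>u. (y + u)\<^sup>2 \<partial>\<psi>) = y\<^sup>2 + 1"
    unfolding eq using integrable_id integrable_square mean_\<psi> var_\<psi> \<psi>.prob_space by simp
  finally show ?thesis by (simp add: ennreal_plus)
qed

lemma nn_integral_square_add_coord:
  assumes [measurable]: "Y \<in> borel_measurable P" and "\<And>w u. Y (w(t := u)) = Y w"
  shows "(\<integral>\<^sup>+w. ennreal ((Y w + w t)\<^sup>2) \<partial>P) = (\<integral>\<^sup>+w. ennreal ((Y w)\<^sup>2) \<partial>P) + 1"
proof -
  have "(\<integral>\<^sup>+w. ennreal ((Y w + w t)\<^sup>2) \<partial>P) = (\<integral>\<^sup>+w. (\<integral>\<^sup>+u. ennreal ((Y w + u)\<^sup>2) \<partial>\<psi>) \<partial>P)"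
    by (subst nn_integral_resample[of _ t]) (auto simp: assms(2))
  then show ?thesis
    by (simp add: nn_integral_square_shift nn_integral_add)
qed

text \<open>The part of \<open>f\<close> above a large level \<open>K\<close> carries mass below
  1/4, and the part up to \<open>K\<close> gives at most \<open>K * (2 * \<eta>)\<close>, which is
  below 1/4, to an interval of length \<open>2 * \<eta>\<close>, wherever it lies. Later this keeps
  X_(t-1) away from 0.\<close>

lemma small_ball:
  obtains \<eta> where "\<eta> > 0" and "\<And>y. emeasure \<psi> {u. \<bar>y + u\<bar> \<le> \<eta>} \<le> ennreal (1/2)"
proof -
  have int1: "(\<integral>\<^sup>+u. ennreal (f u) \<partial>lborel) = 1"
    using emeasure_\<psi>_UNIV unfolding \<psi>_eq by (subst (asm) emeasure_density) auto
  have intf: "integrable lborel f"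
    using int1 f_nonneg by (intro integrableI_nonneg) auto
  have "(\<lambda>K::nat. \<integral>u. (if f u > K then f u else 0) \<partial>lborel) \<longlonglongrightarrow> (\<integral>u. 0 \<partial>(lborel :: real measure))"
  proof (rule integral_dominated_convergence[where w = f])
    show "AE u in lborel. (\<lambda>K::nat. if f u > K then f u else 0) \<longlonglongrightarrow> 0"
    proof (rule AE_I2)
      fix u
      have "\<forall>\<^sub>F K in sequentially. (if f u > real K then f u else 0) = 0"
        using eventually_ge_at_top[of "nat \<lceil>f u\<rceil>"] by eventually_elim (auto simp: nat_le_iff ceiling_le_iff)
      then show "(\<lambda>K::nat. if f u > K then f u else 0) \<longlonglongrightarrow> 0"
        by (rule tendsto_eventually)
    qed
  qed (use intf f_nonneg in auto)
  then have "\<forall>\<^sub>F K::nat in sequentially. (\<integral>u. (if f u > K then f u else 0) \<partial>lborel) < 1/4"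
    by (intro order_tendstoD) auto
  then obtain K :: nat where K: "(\<integral>u. (if f u > K then f u else 0) \<partial>lborel) < 1/4"
    by (auto simp: eventually_sequentially)
  have iK: "integrable lborel (\<lambda>u. if f u > K then f u else 0)"
    by (rule Bochner_Integration.integrable_bound[OF intf]) (use f_nonneg in auto)
  define \<eta> where "\<eta> = 1 / (8 * (real K + 1))"
  have eta: "\<eta> > 0" by (simp add: \<eta>_def)
  have "emeasure \<psi> {u. \<bar>y + u\<bar> \<le> \<eta>} \<le> ennreal (1/2)" for y
  proof -
    have set: "{u. \<bar>y + u\<bar> \<le> \<eta>} = {-y-\<eta>..-y+\<eta>}" by auto
    have "emeasure \<psi> {u. \<bar>y + u\<bar> \<le> \<eta>} = (\<integral>\<^sup>+u. ennreal (f u) * indicator {-y-\<eta>..-y+\<eta>} u \<partial>lborel)"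
      unfolding set \<psi>_eq by (subst emeasure_density) auto
    also have "\<dots> \<le> (\<integral>\<^sup>+u. ennreal (if f u > K then f u else 0) + ennreal K * indicator {-y-\<eta>..-y+\<eta>} u \<partial>lborel)"
      by (rule nn_integral_mono) (auto simp: indicator_def ennreal_leI)
    also have "\<dots> = (\<integral>\<^sup>+u. ennreal (if f u > K then f u else 0) \<partial>lborel) + ennreal K * emeasure lborel {-y-\<eta>..-y+\<eta>}"
      by (subst nn_integral_add) (auto simp: nn_integral_cmult)
    also have "(\<integral>\<^sup>+u. ennreal (if f u > K then f u else 0) \<partial>lborel) = ennreal (\<integral>u. (if f u > K then f u else 0) \<partial>lborel)"
      by (rule nn_integral_eq_integral[OF iK]) (use f_nonneg in auto)
    also have "emeasure lborel {-y-\<eta>..-y+\<eta>} = ennreal (2 * \<eta>)"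
      using eta by simp
    also have "ennreal (\<integral>u. (if f u > K then f u else 0) \<partial>lborel) + ennreal K * ennreal (2*\<eta>) \<le> ennreal (1/4) + ennreal (1/4)"
    proof (rule add_mono)
      show "ennreal (\<integral>u. (if f u > K then f u else 0) \<partial>lborel) \<le> ennreal (1/4)"
        using K by (intro ennreal_leI) simp
      show "ennreal K * ennreal (2*\<eta>) \<le> ennreal (1/4)"
        using eta by (subst ennreal_mult[symmetric]) (auto intro!: ennreal_leI simp: \<eta>_def field_simps)
    qed
    also have "\<dots> = ennreal (1/2)"
      by (subst ennreal_plus[symmetric]) auto
    finally show ?thesis .
  qed
  with eta show thesis by (rule that)
qed

end

section \<open>First-order autoregressions driven by the innovations\<close>

text \<open>The recursion starts from the innovations themselves, since the coefficient will vanish at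
  nonpositive times.\<close>

primrec ar_nat :: "(int \<Rightarrow> real) \<Rightarrow> (int \<Rightarrow> real) \<Rightarrow> nat \<Rightarrow> real" where
  "ar_nat a w 0 = w 0"
| "ar_nat a w (Suc n) = a (int (Suc n)) * ar_nat a w n + w (int (Suc n))"

definition ar :: "(int \<Rightarrow> real) \<Rightarrow> (int \<Rightarrow> real) \<Rightarrow> int \<Rightarrow> real" where
  "ar a w t = (if t \<le> 0 then w t else ar_nat a w (nat t))"

lemma ar_rec:
  assumes "\<And>t. t \<le> 0 \<Longrightarrow> a t = 0"
  shows "ar a w t = a t * ar a w (t - 1) + w t"
proof (cases "t \<le> 0")
  case False
  then obtain n where n: "t = int (Suc n)"
    by (metis gr0_implies_Suc linorder_not_le zero_less_imp_eq_int)
  have "t - 1 = int n" by (simp add: n)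
  then have "ar a w (t - 1) = ar_nat a w n"
    by (cases n) (simp_all add: ar_def del: of_nat_Suc)
  moreover have "ar a w t = ar_nat a w (Suc n)"
    unfolding n ar_def by (simp del: of_nat_Suc ar_nat.simps)
  ultimately show ?thesis by (simp add: n)
qed (simp add: ar_def assms)

lemma ar_nat_update_future: "int n < s \<Longrightarrow> ar_nat a (w(s := u)) n = ar_nat a w n"
  by (induction n) auto

lemma ar_update_future: "t < s \<Longrightarrow> ar a (w(s := u)) t = ar a w t"
  by (auto simp: ar_def ar_nat_update_future)

text \<open>Vanishing of \<open>a\<close> at nonpositive times forces \<open>x t = w t\<close>
  there, which starts the induction. The equations are asked only up to \<open>n\<close>, since a
  process is given up to time \<open>T\<close> and a shear acts up to its horizon.\<close>

lemma ar_unique: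
  assumes "\<And>t. t \<le> 0 \<Longrightarrow> a t = 0" and "\<And>t. t \<le> n \<Longrightarrow> x t = a t * x (t - 1) + w t" and "t \<le> n"
  shows "x t = ar a w t"
proof (cases "t \<le> 0")
  case True
  with assms(1)[of t] assms(2)[of t] assms(3) show ?thesis by (simp add: ar_def)
next
  case False
  have "x (int k) = ar a w (int k)" if "int k \<le> n" for k
    using that
  proof (induction k)
    case 0
    with assms(1)[of 0] assms(2)[of 0] show ?case by (simp add: ar_def)
  next
    case (Suc k)
    from Suc show ?case
      using assms(2)[of "int (Suc k)"] ar_rec[of a w "int (Suc k)"] assms(1) by auto
  qed
  from this[of "nat t"] False assms(3) show ?thesis by simp
qed

section \<open>Moments and law of the first-order autoregression\<close>

context innovations
begin

lemma measurable_ar[measurable]: "(\<lambda>w. ar a w t) \<in> borel_measurable P"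
proof -
  have "(\<lambda>w. ar_nat a w n) \<in> borel_measurable P" for n
    by (induction n) auto
  then show ?thesis by (cases "t \<le> 0") (auto simp: ar_def)
qed

text \<open>Independence of \<open>w t\<close> from the past gives m_t = a_t^2 m_(t-1) + 1 for the
  second moments, and \<open>1 / (1 - \<delta>\<^sup>2)\<close> is the fixed point of the worst case
  of this recursion.\<close>

lemma ar_second_moment:
  assumes "\<And>t. t \<le> 0 \<Longrightarrow> a t = 0" and "\<And>t. \<bar>a t\<bar> \<le> \<delta>" and "\<delta> < 1"
  shows "(\<integral>\<^sup>+w. ennreal ((ar a w t)\<^sup>2) \<partial>P) \<le> ennreal (1 / (1 - \<delta>\<^sup>2))"
proof -
  have d0: "0 \<le> \<delta>" using assms(2)[of 0] by linarith
  with assms(3) have d1: "\<delta>\<^sup>2 < 1" by (simp add: abs_square_less_1)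
  have step: "(\<integral>\<^sup>+w. ennreal ((ar a w t)\<^sup>2) \<partial>P)
      = ennreal ((a t)\<^sup>2) * (\<integral>\<^sup>+w. ennreal ((ar a w (t - 1))\<^sup>2) \<partial>P) + 1" for t
  proof -
    have "(\<integral>\<^sup>+w. ennreal ((ar a w t)\<^sup>2) \<partial>P) = (\<integral>\<^sup>+w. ennreal ((a t * ar a w (t - 1) + w t)\<^sup>2) \<partial>P)"
      by (subst ar_rec[OF assms(1)]) auto
    also have "\<dots> = (\<integral>\<^sup>+w. ennreal ((a t * ar a w (t - 1))\<^sup>2) \<partial>P) + 1"
      by (rule nn_integral_square_add_coord) (auto simp: ar_update_future)
    finally show ?thesis
      by (simp add: power_mult_distrib ennreal_mult nn_integral_cmult)
  qed
  have one: "1 \<le> 1 / (1 - \<delta>\<^sup>2)" using d1 by simp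
  have le: "(\<integral>\<^sup>+w. ennreal ((ar a w t)\<^sup>2) \<partial>P) \<le> ennreal (1 / (1 - \<delta>\<^sup>2))" if "t \<le> 0" for t
    using step[of t] assms(1)[OF that] ennreal_leI[OF one] by simp
  have "(\<integral>\<^sup>+w. ennreal ((ar a w (int k))\<^sup>2) \<partial>P) \<le> ennreal (1 / (1 - \<delta>\<^sup>2))" for k
  proof (induction k)
    case (Suc k)
    have "(a t)\<^sup>2 \<le> \<delta>\<^sup>2" for t
      using power_mono[OF assms(2)[of t], of 2] by simp
    then have "(\<integral>\<^sup>+w. ennreal ((ar a w (int (Suc k)))\<^sup>2) \<partial>P) \<le> ennreal (\<delta>\<^sup>2) * ennreal (1 / (1 - \<delta>\<^sup>2)) + 1"
      using Suc by (subst step) (auto intro!: add_right_mono mult_mono ennreal_leI)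
    also have "\<dots> = ennreal (\<delta>\<^sup>2 * (1 / (1 - \<delta>\<^sup>2)) + 1)"
      using d1 by (simp add: ennreal_mult[symmetric] del: times_divide_eq_right flip: ennreal_1 ennreal_plus)
    also have "\<delta>\<^sup>2 * (1 / (1 - \<delta>\<^sup>2)) + 1 = 1 / (1 - \<delta>\<^sup>2)"
      using d1 by (simp add: field_simps)
    finally show ?case .
  qed (use le in auto)
  from this[of "nat t"] le[of t] show ?thesis by (cases "t \<le> 0") auto
qed

text \<open>Chebyshev's inequality; its uniformity in \<open>t\<close> is what the tightness
  condition of \<open>tvar_process\<close> asks for.\<close>

lemma ar_tail:
  assumes "\<And>t. t \<le> 0 \<Longrightarrow> a t = 0" and "\<And>t. \<bar>a t\<bar> \<le> \<delta>" and "\<delta> < 1" and "K > 0"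
  shows "measure P {w \<in> space P. \<bar>ar a w t\<bar> > K} \<le> 1 / (1 - \<delta>\<^sup>2) / K\<^sup>2"
proof -
  interpret P: prob_space P by (rule prob_P)
  have d1: "\<delta>\<^sup>2 < 1" using assms(2)[of 0] assms(3) by (intro abs_square_less_1[THEN iffD2]) auto
  have "ennreal (K\<^sup>2) * emeasure P {w \<in> space P. \<bar>ar a w t\<bar> > K}
      = (\<integral>\<^sup>+w. ennreal (K\<^sup>2) * indicator {w \<in> space P. \<bar>ar a w t\<bar> > K} w \<partial>P)"
    by (rule nn_integral_cmult_indicator[symmetric]) measurable
  also have "\<dots> \<le> (\<integral>\<^sup>+w. ennreal ((ar a w t)\<^sup>2) \<partial>P)"
    using assms(4) power_mono[of K "\<bar>_\<bar>" 2]
    by (intro nn_integral_mono) (auto simp: indicator_def intro!: ennreal_leI)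
  also have "\<dots> \<le> ennreal (1 / (1 - \<delta>\<^sup>2))"
    using assms by (intro ar_second_moment)
  finally have "ennreal (K\<^sup>2 * measure P {w \<in> space P. \<bar>ar a w t\<bar> > K}) \<le> ennreal (1 / (1 - \<delta>\<^sup>2))"
    by (simp add: P.emeasure_eq_measure ennreal_mult)
  then show ?thesis
    using d1 assms(4) by (subst (asm) ennreal_le_iff) (auto simp: field_simps)
qed

text \<open>Coefficients supported on positive times make \<open>X\<^sub>t = \<xi>\<^sub>t\<close> for \<open>t \<le> 0\<close>, which determines the
  process without any appeal to the tightness condition.\<close>

lemma tvar_law_ar:
  assumes "d \<ge> 1" and "T \<ge> 1" and "\<And>u. u \<le> 0 \<Longrightarrow> \<phi> u = 0" and "\<And>u. \<bar>\<phi> u\<bar> \<le> \<delta>" and "\<delta> < 1"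
  defines "a \<equiv> \<lambda>t. \<phi> (real_of_int (t - 1) / real T)"
  shows "tvar_law d \<psi> T (\<lambda>u j. if j = 1 then \<phi> u else 0) (\<lambda>_. 1)
    = distr P (\<Pi>\<^sub>M t\<in>{..int T}. borel) (\<lambda>w. \<lambda>t\<in>{..int T}. ar a w t)"
proof -
  have a0: "a t = 0" if "t \<le> 0" for t
    unfolding a_def using that assms(2) by (intro assms(3)) (auto simp: divide_le_0_iff)
  have a1: "\<bar>a t\<bar> \<le> \<delta>" for t
    unfolding a_def by (rule assms(4))
  have sum: "(\<Sum>j=1..d. (if j = 1 then y else 0) * X j) = y * X 1" for y and X :: "nat \<Rightarrow> real"
    using assms(1) by (subst sum.cong[OF refl, where h = "\<lambda>j. if j = 1 then y * X j else 0"]) auto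
  define tv where "tv = tvar_process d P (\<lambda>t w. w t) T (\<lambda>u j. if j = 1 then \<phi> u else 0) (\<lambda>_. 1)"
  have ex: "tv (\<lambda>t w. ar a w t)"
    unfolding tv_def tvar_process_def sum
  proof (intro conjI allI impI AE_I2)
    fix t :: int and w :: "int \<Rightarrow> real"
    show "ar a w t = \<phi> (real_of_int (t - 1) / real T) * ar a w (t - int 1) + 1 * w t"
      using ar_rec[OF a0, where w = w and t = t] by (simp add: a_def)
  next
    let ?s = "\<lambda>K. SUP t\<in>{..int T}. measure P {w \<in> space P. \<bar>ar a w t\<bar> > K}"
    show "(?s \<longlongrightarrow> 0) at_top"
    proof (rule tendsto_sandwich)
      \<comment> \<open>A supremum of reals dominates its members only for a bounded family, so
        boundedness comes first.\<close>
      have "bdd_above ((\<lambda>t. measure P {w \<in> space P. \<bar>ar a w t\<bar> > K}) ` {..int T})" for K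
        using prob_space.prob_le_1[OF prob_P] by (intro bdd_aboveI[of _ 1]) auto
      then have "0 \<le> ?s K" for K
        by (intro cSUP_upper2[where x = 0]) auto
      then show "\<forall>\<^sub>F K in at_top. 0 \<le> ?s K" by simp
      show "\<forall>\<^sub>F K in at_top. ?s K \<le> 1 / (1 - \<delta>\<^sup>2) / K\<^sup>2"
        using eventually_gt_at_top[of 0]
      proof eventually_elim
        case (elim K)
        show ?case
          by (intro cSUP_least ar_tail a0 a1 assms elim) auto
      qed
      show "((\<lambda>K. 1 / (1 - \<delta>\<^sup>2) / K\<^sup>2) \<longlongrightarrow> 0) at_top"
        by (intro real_tendsto_divide_at_top[OF tendsto_const] filterlim_pow_at_top filterlim_ident) auto
    qed simp
  qed auto
  have uniq: "distr P (\<Pi>\<^sub>M t\<in>{..int T}. borel) (\<lambda>w. \<lambda>t\<in>{..int T}. X t w)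
      = distr P (\<Pi>\<^sub>M t\<in>{..int T}. borel) (\<lambda>w. \<lambda>t\<in>{..int T}. ar a w t)" if "tv X" for X
  proof (rule distr_cong_AE)
    have "AE w in P. \<forall>t\<le>int T. X t w = a t * X (t - 1) w + w t"
      using that unfolding tv_def tvar_process_def sum by (simp add: a_def)
    then show "AE w in P. (\<lambda>t\<in>{..int T}. X t w) = (\<lambda>t\<in>{..int T}. ar a w t)"
    proof eventually_elim
      case (elim w)
      show ?case
      proof (rule restrict_ext)
        fix t assume "t \<in> {..int T}"
        then show "X t w = ar a w t"
          using elim by (intro ar_unique[OF a0, where n = "int T" and x = "\<lambda>t. X t w"]) (blast, blast, simp)
      qed
    qed
    have [measurable]: "X t \<in> borel_measurable P" if "t \<le> int T" for t
      using \<open>tv X\<close> that by (simp add: tv_def tvar_process_def)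
    show "(\<lambda>w. \<lambda>t\<in>{..int T}. X t w) \<in> measurable P (\<Pi>\<^sub>M t\<in>{..int T}. borel)"
      by (rule measurable_restrict) auto
    show "(\<lambda>w. \<lambda>t\<in>{..int T}. ar a w t) \<in> measurable P (\<Pi>\<^sub>M t\<in>{..int T}. borel)"
      by (rule measurable_restrict) auto
  qed auto
  \<comment> \<open>\<open>THE\<close> ranges over laws, not processes: solutions may differ on a
    null set and still have the same law.\<close>
  show ?thesis
    unfolding tvar_law_def P_def[symmetric] tv_def[symmetric]
    by (rule the_equality) (use ex uniq in blast)+
qed

text \<open>Given the past, X_t is a_t X_(t-1) plus an innovation of mean 0 and variance 1, so the
  squared error splits; the summand 1 is the noise level subtracted in the risk. Nonnegative
  integrals also cover predictors of infinite risk.\<close>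

lemma prediction_error_ar:
  assumes "d \<ge> 1" and "T \<ge> 1" and "\<And>u. u \<le> 0 \<Longrightarrow> \<phi> u = 0" and "\<And>u. \<bar>\<phi> u\<bar> \<le> \<delta>" and "\<delta> < 1"
    and g: "g \<in> predictors T" and t: "t \<in> {1..int T}"
  defines "a \<equiv> \<lambda>t. \<phi> (real_of_int (t - 1) / real T)"
  shows "prediction_error d \<psi> T (\<lambda>u j. if j = 1 then \<phi> u else 0) (\<lambda>_. 1) g t
    = enn2ereal ((\<integral>\<^sup>+w. ennreal ((g t (\<lambda>s\<in>{..t-1}. ar a w s) - a t * ar a w (t - 1))\<^sup>2) \<partial>P) + 1)"
proof -
  have a0: "a t = 0" if "t \<le> 0" for t
    unfolding a_def using that assms(2) by (intro assms(3)) (auto simp: divide_le_0_iff)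
  have [measurable]: "g t \<in> borel_measurable (\<Pi>\<^sub>M s\<in>{..t - 1}. borel)"
    using g t by (simp add: predictors_def)
  have [measurable]: "(\<lambda>w. g t (\<lambda>s\<in>{..t-1}. ar a w s)) \<in> borel_measurable P"
    by (rule measurable_compose[of _ _ "\<Pi>\<^sub>M s\<in>{..t - 1}. borel"], rule measurable_restrict) auto
  have [measurable]: "(\<lambda>x. restrict x {..t - 1}) \<in> measurable (\<Pi>\<^sub>M s\<in>{..int T}. borel) (\<Pi>\<^sub>M s\<in>{..t - 1}. borel)"
    using t by (intro measurable_restrict_subset) auto
  have [measurable]: "(\<lambda>x. x t) \<in> borel_measurable (\<Pi>\<^sub>M s\<in>{..int T}. borel)"
    using t by (intro measurable_component_singleton) auto
  have m: "(\<lambda>w. \<lambda>t\<in>{..int T}. ar a w t) \<in> measurable P (\<Pi>\<^sub>M t\<in>{..int T}. borel)"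
    by (rule measurable_restrict) auto
  have "(\<integral>\<^sup>+x. ennreal ((g t (restrict x {..t - 1}) - x t)\<^sup>2)
        \<partial>tvar_law d \<psi> T (\<lambda>u j. if j = 1 then \<phi> u else 0) (\<lambda>_. 1))
      = (\<integral>\<^sup>+w. ennreal ((g t (restrict (\<lambda>t\<in>{..int T}. ar a w t) {..t - 1}) - (\<lambda>t\<in>{..int T}. ar a w t) t)\<^sup>2) \<partial>P)"
    by (simp only: tvar_law_ar[OF assms(1-5)] flip: a_def) (rule nn_integral_distr[OF m], simp)
  also have "\<dots> = (\<integral>\<^sup>+w. ennreal (((a t * ar a w (t - 1) - g t (\<lambda>s\<in>{..t-1}. ar a w s)) + w t)\<^sup>2) \<partial>P)"
  proof (rule nn_integral_cong)
    fix w
    have "{..int T} \<inter> {..t - 1} = {..t - 1}" using t by auto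
    then show "ennreal ((g t (restrict (\<lambda>t\<in>{..int T}. ar a w t) {..t - 1}) - (\<lambda>t\<in>{..int T}. ar a w t) t)\<^sup>2)
        = ennreal (((a t * ar a w (t - 1) - g t (\<lambda>s\<in>{..t-1}. ar a w s)) + w t)\<^sup>2)"
      using ar_rec[OF a0, where w = w and t = t] t
      by (subst power2_commute) (simp add: algebra_simps)
  qed
  also have "\<dots> = (\<integral>\<^sup>+w. ennreal ((a t * ar a w (t - 1) - g t (\<lambda>s\<in>{..t-1}. ar a w s))\<^sup>2) \<partial>P) + 1"
  proof (rule nn_integral_square_add_coord)
    fix w u
    have "(\<lambda>s\<in>{..t-1}. ar a (w(t := u)) s) = (\<lambda>s\<in>{..t-1}. ar a w s)"
      by (rule restrict_ext) (auto simp: ar_update_future)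
    then show "a t * ar a (w(t := u)) (t - 1) - g t (\<lambda>s\<in>{..t-1}. ar a (w(t := u)) s)
      = a t * ar a w (t - 1) - g t (\<lambda>s\<in>{..t-1}. ar a w s)"
      by (simp add: ar_update_future)
  qed auto
  finally show ?thesis
    unfolding prediction_error_def by (subst (asm) power2_commute) simp
qed

end

section \<open>Change of measure by adapted shifts\<close>

text \<open>The shift is evaluated at the original \<open>w\<close>. When \<open>v s\<close> ignores
  the coordinates from \<open>s\<close> on, as in the lemmas below, the map is triangular with unit
  diagonal.\<close>

definition shear :: "(int \<Rightarrow> (int \<Rightarrow> real) \<Rightarrow> real) \<Rightarrow> nat \<Rightarrow> (int \<Rightarrow> real) \<Rightarrow> int \<Rightarrow> real" where
  "shear v n w = (\<lambda>s. if 1 \<le> s \<and> s \<le> int n then w s + v s w else w s)"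

text \<open>The product of the conditional density ratios at times 1 to \<open>n\<close>. Division
  by zero makes a factor 0 where \<open>f\<close> vanishes at the unshifted innovation.\<close>

definition shear_lik :: "(real \<Rightarrow> real) \<Rightarrow> (int \<Rightarrow> (int \<Rightarrow> real) \<Rightarrow> real) \<Rightarrow> nat \<Rightarrow> (int \<Rightarrow> real) \<Rightarrow> real" where
  "shear_lik f v n w = (\<Prod>k<n. f (w (int (Suc k)) + v (int (Suc k)) w) / f (w (int (Suc k))))"

context innovations
begin

text \<open>The density \<open>f u\<close> cancels the denominator and translation invariance of
  Lebesgue measure removes \<open>c\<close>. Where \<open>f u = 0\<close> the quotient is 0 by
  convention and mass may be lost, hence \<open>\<le>\<close>.\<close>

lemma nn_integral_shift_ratio_le:
  assumes [measurable]: "H \<in> borel_measurable borel"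
  shows "(\<integral>\<^sup>+u. H (u + c) * ennreal (f (u + c) / f u) \<partial>\<psi>) \<le> (\<integral>\<^sup>+u. H u \<partial>\<psi>)"
proof -
  have "(\<integral>\<^sup>+u. H (u + c) * ennreal (f (u + c) / f u) \<partial>\<psi>)
      = (\<integral>\<^sup>+u. ennreal (f u) * (H (u + c) * ennreal (f (u + c) / f u)) \<partial>lborel)"
    unfolding \<psi>_eq by (subst nn_integral_density) auto
  also have "\<dots> \<le> (\<integral>\<^sup>+u. ennreal (f (u + c)) * H (u + c) \<partial>lborel)"
  proof (rule nn_integral_mono)
    fix u
    have "ennreal (f u) * ennreal (f (u + c) / f u) \<le> ennreal (f (u + c))"
      using f_nonneg by (cases "f u = 0") (auto simp flip: ennreal_mult)
    from mult_right_mono[OF this, of "H (u + c)"]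
    show "ennreal (f u) * (H (u + c) * ennreal (f (u + c) / f u)) \<le> ennreal (f (u + c)) * H (u + c)"
      by (simp add: mult_ac)
  qed
  also have "\<dots> = (\<integral>\<^sup>+u. ennreal (f u) * H u \<partial>lborel)"
    by (subst (2) nn_integral_real_affine[where c = 1 and t = c]) (auto simp: add.commute)
  also have "\<dots> = (\<integral>\<^sup>+u. H u \<partial>\<psi>)"
    unfolding \<psi>_eq by (subst nn_integral_density) auto
  finally show ?thesis .
qed

lemma measurable_shear[measurable]:
  assumes [measurable]: "\<And>s. v s \<in> borel_measurable P"
  shows "shear v n \<in> measurable P P"
proof -
  have "shear v n \<in> measurable P (PiM UNIV (\<lambda>_. borel))"
    unfolding shear_def by (rule measurable_PiM_single') auto
  then show ?thesis by measurable
qed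

lemma measurable_shear_lik[measurable]:
  assumes [measurable]: "\<And>s. v s \<in> borel_measurable P"
  shows "shear_lik f v n \<in> borel_measurable P"
  unfolding shear_lik_def by measurable

lemma shear_lik_nonneg: "0 \<le> shear_lik f v n w"
  unfolding shear_lik_def using f_nonneg by (intro prod_nonneg) auto

lemma shear_update:
  assumes "\<And>s t w u. s \<le> t \<Longrightarrow> v s (w(t := u)) = v s w"
  shows "shear v n (w(int (Suc n) := u)) = (shear v n w)(int (Suc n) := u)"
    and "shear v (Suc n) (w(int (Suc n) := u)) = (shear v n w)(int (Suc n) := u + v (int (Suc n)) w)"
  using assms by (auto simp: shear_def fun_eq_iff)

lemma shear_lik_update:
  assumes "\<And>s t w u. s \<le> t \<Longrightarrow> v s (w(t := u)) = v s w"
  shows "shear_lik f v n (w(int (Suc n) := u)) = shear_lik f v n w"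
    and "shear_lik f v (Suc n) (w(int (Suc n) := u))
      = shear_lik f v n w * (f (u + v (int (Suc n)) w) / f u)"
proof -
  show *: "shear_lik f v n (w(int (Suc n) := u)) = shear_lik f v n w"
    unfolding shear_lik_def using assms by (intro prod.cong) auto
  have "shear_lik f v (Suc n) w' = shear_lik f v n w' *
      (f (w' (int (Suc n)) + v (int (Suc n)) w') / f (w' (int (Suc n))))" for w'
    unfolding shear_lik_def by (rule prod.lessThan_Suc)
  then show "shear_lik f v (Suc n) (w(int (Suc n) := u))
      = shear_lik f v n w * (f (u + v (int (Suc n)) w) / f u)"
    using assms by (simp only: * fun_upd_same)
qed

text \<open>Only an inequality, because \<open>f\<close> is not known to be positive on the whole shifted support.\<close>

lemma nn_integral_shear_le:
  assumes [measurable]: "\<And>s. v s \<in> borel_measurable P"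
    and adapted: "\<And>s t w u. s \<le> t \<Longrightarrow> v s (w(t := u)) = v s w"
    and "F \<in> borel_measurable P"
  shows "(\<integral>\<^sup>+w. F (shear v n w) * ennreal (shear_lik f v n w) \<partial>P) \<le> (\<integral>\<^sup>+w. F w \<partial>P)"
  using assms(3)
proof (induction n arbitrary: F)
  case 0
  have "shear v 0 w = w" for w
    by (auto simp: shear_def)
  then show ?case by (simp add: shear_lik_def)
next
  case (Suc n)
  note [measurable] = Suc.prems
  define s where "s = int (Suc n)"
  have mF: "(\<lambda>u. F (w'(s := u))) \<in> borel_measurable borel" for w'
    by measurable
  then have mF': "(\<lambda>u. F (w'(s := u))) \<in> borel_measurable \<psi>" for w'
    by (simp cong: measurable_cong_sets)
  note upd = shear_update[OF adapted, where n = n, folded s_def]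
    shear_lik_update[OF adapted, where n = n, folded s_def]
  \<comment> \<open>The last time is integrated out first: with the other innovations fixed its
    shift is a constant, and its ratio is the only factor of the likelihood that involves
    \<open>u\<close>.\<close>
  have "(\<integral>\<^sup>+w. F (shear v (Suc n) w) * ennreal (shear_lik f v (Suc n) w) \<partial>P)
      = (\<integral>\<^sup>+w. (\<integral>\<^sup>+u. F ((shear v n w)(s := u + v s w)) *
            ennreal (shear_lik f v n w * (f (u + v s w) / f u)) \<partial>\<psi>) \<partial>P)"
    by (subst nn_integral_resample[of _ s]) (simp_all only: upd, measurable)
  also have "\<dots> = (\<integral>\<^sup>+w. ennreal (shear_lik f v n w) * (\<integral>\<^sup>+u. F ((shear v n w)(s := u + v s w)) *
            ennreal (f (u + v s w) / f u) \<partial>\<psi>) \<partial>P)"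
  proof (rule nn_integral_cong)
    fix w
    define H where "H = (\<lambda>u. F ((shear v n w)(s := u)))"
    define c where "c = v s w"
    have [measurable]: "H \<in> borel_measurable borel"
      unfolding H_def by (rule mF)
    have "(\<lambda>u. H (u + c) * ennreal (f (u + c) / f u)) \<in> borel_measurable borel"
      by measurable
    then have [measurable]: "(\<lambda>u. H (u + c) * ennreal (f (u + c) / f u)) \<in> borel_measurable \<psi>"
      by (simp cong: measurable_cong_sets)
    show "(\<integral>\<^sup>+u. F ((shear v n w)(s := u + v s w)) * ennreal (shear_lik f v n w * (f (u + v s w) / f u)) \<partial>\<psi>)
      = ennreal (shear_lik f v n w) * (\<integral>\<^sup>+u. F ((shear v n w)(s := u + v s w)) * ennreal (f (u + v s w) / f u) \<partial>\<psi>)"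
      unfolding H_def[symmetric, THEN fun_cong] c_def[symmetric]
      by (subst nn_integral_cmult[symmetric])
         (auto simp: ennreal_mult'[OF shear_lik_nonneg] mult_ac simp del: times_divide_eq_right)
  qed
  also have "\<dots> \<le> (\<integral>\<^sup>+w. ennreal (shear_lik f v n w) * (\<integral>\<^sup>+u. F ((shear v n w)(s := u)) \<partial>\<psi>) \<partial>P)"
    by (intro nn_integral_mono mult_left_mono nn_integral_shift_ratio_le mF) auto
  also have "\<dots> = (\<integral>\<^sup>+w. (\<integral>\<^sup>+u. F ((shear v n w)(s := u)) * ennreal (shear_lik f v n w) \<partial>\<psi>) \<partial>P)"
    by (intro nn_integral_cong, subst nn_integral_cmult[symmetric]) (simp_all add: mF' mult_ac)
  \<comment> \<open>The same resampling, read backwards, restores an integral with horizon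
    \<open>n\<close>.\<close>
  also have "\<dots> = (\<integral>\<^sup>+w. F (shear v n w) * ennreal (shear_lik f v n w) \<partial>P)"
    by (subst (2) nn_integral_resample[of _ s]) (simp_all only: upd, measurable)
  also have "\<dots> \<le> (\<integral>\<^sup>+w. F w \<partial>P)"
    by (rule Suc.IH) fact
  finally show ?case .
qed

end

section \<open>Relative entropy of shifted innovations\<close>

text \<open>Clears the factor \<open>1 / v\<^sup>2\<close> of the supremum. The shift 0, absent from
  the supremum, has a vanishing integrand; a natural number above the supremum serves as nonnegative
  real constant.\<close>

lemma kl_shift_const_finite:
  assumes "kl_shift_const f < \<infinity>"
  obtains \<kappa> where "\<kappa> \<ge> 0" and "\<And>c. kl_shift f c \<le> ereal (\<kappa> * c\<^sup>2)"
proof -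
  obtain k :: nat where k: "kl_shift_const f < ereal (real k)"
    using assms less_PInf_Ex_of_nat by auto
  have "kl_shift f c \<le> ereal (real k * c\<^sup>2)" for c
  proof (cases "c = 0")
    case True
    have "kl_shift_integrand f 0 u = 0" for u
      by (simp add: kl_shift_integrand_def zero_ereal_def)
    then show ?thesis by (simp add: kl_shift_def True zero_ereal_def[symmetric])
  next
    case False
    have "ereal (1 / c\<^sup>2) * kl_shift f c \<le> kl_shift_const f"
      unfolding kl_shift_const_def using False by (intro SUP_upper) auto
    also note less_imp_le[OF k]
    finally have le: "ereal (c\<^sup>2) * (ereal (1 / c\<^sup>2) * kl_shift f c) \<le> ereal (c\<^sup>2) * ereal (real k)"
      by (rule ereal_mult_left_mono) auto
    have "ereal (c\<^sup>2) * ereal (1 / c\<^sup>2) = 1"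
      using False by (simp add: one_ereal_def)
    then have "ereal (c\<^sup>2) * (ereal (1 / c\<^sup>2) * kl_shift f c) = kl_shift f c"
      by (simp only: mult.assoc[symmetric] mult_1)
    with le show ?thesis by (simp add: mult.commute)
  qed
  then show thesis by (intro that[of "real k"]) auto
qed

context innovations
begin

text \<open>The conventions agree on negative parts: where \<open>f u > 0 = f (u + c)\<close> the
  integrand is infinite, with negative part 0, and the real quotient and its logarithm are
  0.\<close>

lemma nn_integral_log_ratio_neg:
  "(\<integral>\<^sup>+u. ennreal (- ln (f u / f (u + c))) \<partial>\<psi>) = (\<integral>\<^sup>+u. e2ennreal (- kl_shift_integrand f c u) \<partial>lborel)"
proof -
  have "ennreal (f u) * ennreal (- ln (f u / f (u + c))) = e2ennreal (- kl_shift_integrand f c u)" for u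
    using f_nonneg[of u]
    by (auto simp: kl_shift_integrand_def ennreal_def[symmetric] e2ennreal_neg simp flip: ennreal_mult')
  then show ?thesis
    unfolding \<psi>_eq by (subst nn_integral_density) auto
qed

text \<open>The inequality \<open>ln x \<le> x - 1\<close> bounds the negative part by the density
  ratio, whose integral is at most 1.\<close>

lemma nn_integral_log_ratio_neg_le: "(\<integral>\<^sup>+u. ennreal (- ln (f u / f (u + c))) \<partial>\<psi>) \<le> 1"
proof -
  have "(\<integral>\<^sup>+u. ennreal (- ln (f u / f (u + c))) \<partial>\<psi>) \<le> (\<integral>\<^sup>+u. 1 * ennreal (f (u + c) / f u) \<partial>\<psi>)"
  proof (rule nn_integral_mono)
    fix u
    have "- ln (f u / f (u + c)) \<le> f (u + c) / f u"
    proof (cases "f u = 0 \<or> f (u + c) = 0")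
      case False
      then have "f u > 0" "f (u + c) > 0" using f_nonneg[of u] f_nonneg[of "u + c"] by auto
      then show ?thesis
        using ln_le_minus_one[of "f (u + c) / f u"] by (simp add: ln_div)
    qed auto
    then show "ennreal (- ln (f u / f (u + c))) \<le> 1 * ennreal (f (u + c) / f u)"
      by (simp add: ennreal_leI)
  qed
  also have "\<dots> \<le> (\<integral>\<^sup>+u. 1 \<partial>\<psi>)"
    by (rule nn_integral_shift_ratio_le) auto
  finally show ?thesis by simp
qed

end

locale kl_innovations = innovations +
  fixes \<kappa> :: real
  assumes \<kappa>_nonneg: "0 \<le> \<kappa>" and kl_le: "\<And>c. kl_shift f c \<le> ereal (\<kappa> * c\<^sup>2)"
begin

text \<open>The negative part is finite, so it can be moved to the right; a difference of extended
  reals becomes an inequality in \<open>ennreal\<close>.\<close>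

lemma nn_integral_kl_le:
  "(\<integral>\<^sup>+u. e2ennreal (kl_shift_integrand f c u) \<partial>lborel)
     \<le> ennreal (\<kappa> * c\<^sup>2) + (\<integral>\<^sup>+u. ennreal (- ln (f u / f (u + c))) \<partial>\<psi>)"
proof -
  define p where "p = (\<integral>\<^sup>+u. e2ennreal (kl_shift_integrand f c u) \<partial>lborel)"
  define q where "q = (\<integral>\<^sup>+u. ennreal (- ln (f u / f (u + c))) \<partial>\<psi>)"
  have "enn2ereal p - enn2ereal q \<le> ereal (\<kappa> * c\<^sup>2)"
    using kl_le[of c] unfolding kl_shift_def p_def q_def nn_integral_log_ratio_neg .
  moreover have "q \<le> 1" unfolding q_def by (rule nn_integral_log_ratio_neg_le)
  then obtain r where r: "q = ennreal r" "0 \<le> r" by (cases q) (auto simp: top_unique)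
  ultimately have "enn2ereal p \<le> ereal (\<kappa> * c\<^sup>2 + r)"
    by (cases "enn2ereal p") (auto simp: enn2ereal_ennreal)
  then have "p \<le> ennreal (\<kappa> * c\<^sup>2 + r)"
    using \<kappa>_nonneg r by (simp add: less_eq_ennreal.rep_eq enn2ereal_ennreal del: ennreal_plus)
  also have "\<dots> = ennreal (\<kappa> * c\<^sup>2) + q"
    using \<kappa>_nonneg r by (simp add: ennreal_plus)
  finally show ?thesis unfolding p_def q_def .
qed

lemma measurable_kl_shift_integrand[measurable]: "kl_shift_integrand f c \<in> borel_measurable borel"
  unfolding kl_shift_integrand_def by measurable

text \<open>Where the integrand is infinite the real logarithm is 0, so the positive parts compare
  pointwise in one direction only.\<close>

lemma nn_integral_log_ratio_pos_le:
  "(\<integral>\<^sup>+u. ennreal (ln (f u / f (u + c))) \<partial>\<psi>)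
     \<le> ennreal (\<kappa> * c\<^sup>2) + (\<integral>\<^sup>+u. ennreal (- ln (f u / f (u + c))) \<partial>\<psi>)"
proof -
  have "ennreal (f u) * ennreal (ln (f u / f (u + c))) \<le> e2ennreal (kl_shift_integrand f c u)" for u
    using f_nonneg[of u]
    by (auto simp: kl_shift_integrand_def ennreal_def[symmetric] simp flip: ennreal_mult')
  then have "(\<integral>\<^sup>+u. ennreal (ln (f u / f (u + c))) \<partial>\<psi>)
      \<le> (\<integral>\<^sup>+u. e2ennreal (kl_shift_integrand f c u) \<partial>lborel)"
    unfolding \<psi>_eq by (subst nn_integral_density) (auto intro!: nn_integral_mono)
  also note nn_integral_kl_le
  finally show ?thesis .
qed

text \<open>The integrand is infinite where \<open>f u > 0 = f (u + c)\<close>, so finiteness of the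
  positive part makes this set null.\<close>

lemma AE_shift_pos: "AE u in \<psi>. f u > 0 \<and> f (u + c) > 0"
proof -
  have "(\<integral>\<^sup>+u. e2ennreal (kl_shift_integrand f c u) \<partial>lborel) \<le> ennreal (\<kappa> * c\<^sup>2) + 1"
    using nn_integral_kl_le[of c] nn_integral_log_ratio_neg_le[of c] by (meson add_left_mono order_trans)
  also have "\<dots> < \<infinity>" by (simp add: ennreal_add_less_top)
  finally have "AE u in lborel. e2ennreal (kl_shift_integrand f c u) \<noteq> \<infinity>"
    by (intro nn_integral_noteq_infinite) auto
  then have "AE u in lborel. 0 < ennreal (f u) \<longrightarrow> f u > 0 \<and> f (u + c) > 0"
  proof eventually_elim
    case (elim u)
    then show ?case
      using f_nonneg[of "u + c"] by (auto simp: kl_shift_integrand_def split: if_splits)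
  qed
  then show ?thesis
    unfolding \<psi>_eq by (subst AE_density) auto
qed

end

section \<open>Likelihood ratio of the shear and comparison of two coefficients\<close>

context kl_innovations
begin

text \<open>\<open>v\<close> ignores innovation \<open>s\<close>, so in the inner integral it is a
  constant shift: the fixed-shift bounds apply, and \<open>\<kappa> * (v w)\<^sup>2\<close> is then
  averaged over \<open>w\<close>.\<close>

lemma log_ratio_step:
  assumes [measurable]: "v \<in> borel_measurable P" and upd: "\<And>w u. v (w(s := u)) = v w"
    and B: "(\<integral>\<^sup>+w. ennreal ((v w)\<^sup>2) \<partial>P) \<le> ennreal B" "0 \<le> B"
  shows AE_ratio_pos: "AE w in P. f (w s) > 0 \<and> f (w s + v w) > 0"
    and integrable_log_ratio: "integrable P (\<lambda>w. ln (f (w s) / f (w s + v w)))"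
    and integral_log_ratio_le: "(\<integral>w. ln (f (w s) / f (w s + v w)) \<partial>P) \<le> \<kappa> * B"
proof -
  interpret \<psi>: prob_space \<psi> by (rule prob_\<psi>)
  define L where "L = (\<lambda>w. ln (f (w s) / f (w s + v w)))"
  have [measurable]: "L \<in> borel_measurable P" unfolding L_def by measurable
  \<comment> \<open>The indicator of the exceptional event, resampled at \<open>s\<close>, has inner
    integral 0 for every \<open>w\<close>.\<close>
  have "(\<integral>\<^sup>+w. (if f (w s) > 0 \<and> f (w s + v w) > 0 then 0 else 1 :: ennreal) \<partial>P)
      = (\<integral>\<^sup>+w. (\<integral>\<^sup>+u. (if f u > 0 \<and> f (u + v w) > 0 then 0 else 1 :: ennreal) \<partial>\<psi>) \<partial>P)"
    by (subst nn_integral_resample[of _ s]) (simp_all add: upd del: nn_integral_indicator cong: if_cong)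
  also have "\<dots> = (\<integral>\<^sup>+w. 0 \<partial>P)"
  proof (rule nn_integral_cong)
    fix w
    have "(\<integral>\<^sup>+u. (if f u > 0 \<and> f (u + v w) > 0 then 0 else 1 :: ennreal) \<partial>\<psi>) = (\<integral>\<^sup>+u. 0 \<partial>\<psi>)"
      using AE_shift_pos[of "v w"] by (intro nn_integral_cong_AE) (auto elim!: eventually_mono)
    then show "(\<integral>\<^sup>+u. (if f u > 0 \<and> f (u + v w) > 0 then 0 else 1 :: ennreal) \<partial>\<psi>) = 0" by simp
  qed
  finally have "(\<integral>\<^sup>+w. (if f (w s) > 0 \<and> f (w s + v w) > 0 then 0 else 1 :: ennreal) \<partial>P) = 0"
    by simp
  then show "AE w in P. f (w s) > 0 \<and> f (w s + v w) > 0"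
    by (subst (asm) nn_integral_0_iff_AE) (auto elim!: eventually_mono split: if_splits)

  have neg: "(\<integral>\<^sup>+w. ennreal (- L w) \<partial>P) = (\<integral>\<^sup>+w. (\<integral>\<^sup>+u. ennreal (- ln (f u / f (u + v w))) \<partial>\<psi>) \<partial>P)"
    unfolding L_def by (subst nn_integral_resample[of _ s]) (auto simp: upd)
  have "\<dots> \<le> (\<integral>\<^sup>+w. 1 \<partial>P)"
    by (intro nn_integral_mono nn_integral_log_ratio_neg_le)
  with neg have neg1: "(\<integral>\<^sup>+w. ennreal (- L w) \<partial>P) \<le> 1" by simp
  have "(\<integral>\<^sup>+w. ennreal (L w) \<partial>P) = (\<integral>\<^sup>+w. (\<integral>\<^sup>+u. ennreal (ln (f u / f (u + v w))) \<partial>\<psi>) \<partial>P)"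
    unfolding L_def by (subst nn_integral_resample[of _ s]) (auto simp: upd)
  also have "\<dots> \<le> (\<integral>\<^sup>+w. ennreal (\<kappa> * (v w)\<^sup>2) + (\<integral>\<^sup>+u. ennreal (- ln (f u / f (u + v w))) \<partial>\<psi>) \<partial>P)"
    by (intro nn_integral_mono nn_integral_log_ratio_pos_le)
  also have "\<dots> = (\<integral>\<^sup>+w. ennreal (\<kappa> * (v w)\<^sup>2) \<partial>P) + (\<integral>\<^sup>+w. ennreal (- L w) \<partial>P)"
    unfolding neg by (rule nn_integral_add) auto
  also have "(\<integral>\<^sup>+w. ennreal (\<kappa> * (v w)\<^sup>2) \<partial>P) = ennreal \<kappa> * (\<integral>\<^sup>+w. ennreal ((v w)\<^sup>2) \<partial>P)"
    using \<kappa>_nonneg by (simp add: ennreal_mult nn_integral_cmult)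
  also have "\<dots> \<le> ennreal \<kappa> * ennreal B"
    by (intro mult_left_mono B) auto
  also have "\<dots> = ennreal (\<kappa> * B)"
    using \<kappa>_nonneg B by (simp add: ennreal_mult)
  finally have pos: "(\<integral>\<^sup>+w. ennreal (L w) \<partial>P) \<le> ennreal (\<kappa> * B) + (\<integral>\<^sup>+w. ennreal (- L w) \<partial>P)"
    by (simp add: add_right_mono)
  have fin: "(\<integral>\<^sup>+w. ennreal (- L w) \<partial>P) < \<infinity>" "(\<integral>\<^sup>+w. ennreal (L w) \<partial>P) < \<infinity>"
  proof -
    show *: "(\<integral>\<^sup>+w. ennreal (- L w) \<partial>P) < \<infinity>"
      using neg1 by (rule order_le_less_trans) simp
    show "(\<integral>\<^sup>+w. ennreal (L w) \<partial>P) < \<infinity>"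
      using pos * by (auto intro: order_le_less_trans)
  qed
  then have int: "integrable P L"
    unfolding real_integrable_def by auto
  then show "integrable P (\<lambda>w. ln (f (w s) / f (w s + v w)))" by (simp add: L_def)
  \<comment> \<open>The finite negative part occurs on both sides and cancels.\<close>
  obtain q where q: "(\<integral>\<^sup>+w. ennreal (- L w) \<partial>P) = ennreal q" "0 \<le> q"
    using fin(1) by (cases "\<integral>\<^sup>+w. ennreal (- L w) \<partial>P") auto
  have "(\<integral>w. L w \<partial>P) = enn2real (\<integral>\<^sup>+w. ennreal (L w) \<partial>P) - enn2real (\<integral>\<^sup>+w. ennreal (- L w) \<partial>P)"
    by (rule real_lebesgue_integral_def[OF int])
  moreover have "(\<integral>\<^sup>+w. ennreal (L w) \<partial>P) \<le> ennreal (\<kappa> * B + q)"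
    using pos \<kappa>_nonneg B q by simp
  then have "enn2real (\<integral>\<^sup>+w. ennreal (L w) \<partial>P) \<le> \<kappa> * B + q"
    using \<kappa>_nonneg B q by (intro enn2real_leI) auto
  ultimately have "(\<integral>w. L w \<partial>P) \<le> \<kappa> * B"
    using q by simp
  then show "(\<integral>w. ln (f (w s) / f (w s + v w)) \<partial>P) \<le> \<kappa> * B" by (simp add: L_def)
qed

text \<open>With \<open>Z\<close> the negative log-likelihood ratio, \<open>Z + exp (- Z)\<close> is positive, so Markov's
  inequality applies to it even though \<open>Z\<close> itself may be negative.\<close>

lemma shear_lik_small_prob:
  assumes [measurable]: "\<And>s. v s \<in> borel_measurable P"
    and adapted: "\<And>s t w u. s \<le> t \<Longrightarrow> v s (w(t := u)) = v s w"
    and B: "\<And>s. (\<integral>\<^sup>+w. ennreal ((v s w)\<^sup>2) \<partial>P) \<le> ennreal (B s)" "\<And>s. 0 \<le> B s"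
    and "K > 0"
  shows "measure P {w \<in> space P. shear_lik f v n w < exp (- K)}
    \<le> (\<kappa> * (\<Sum>k<n. B (int (Suc k))) + 1) / K"
proof -
  interpret P: prob_space P by (rule prob_P)
  define L where "L = (\<lambda>k w. ln (f (w (int (Suc k))) / f (w (int (Suc k)) + v (int (Suc k)) w)))"
  define Z where "Z = (\<lambda>w. \<Sum>k<n. L k w)"
  note step = log_ratio_step[OF assms(1) adapted[OF order_refl] B]
  have intZ: "integrable P Z"
    unfolding Z_def L_def by (intro Bochner_Integration.integrable_sum step)
  have Zle: "(\<integral>w. Z w \<partial>P) \<le> \<kappa> * (\<Sum>k<n. B (int (Suc k)))"
    unfolding Z_def sum_distrib_left
    by (subst Bochner_Integration.integral_sum) (auto simp: L_def intro!: sum_mono step)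
  have "AE w in P. \<forall>k\<in>{..<n}. f (w (int (Suc k))) > 0 \<and> f (w (int (Suc k)) + v (int (Suc k)) w) > 0"
    by (intro AE_finite_allI step) auto
  then have lik: "AE w in P. shear_lik f v n w = exp (- Z w)"
  proof eventually_elim
    case (elim w)
    have "exp (- Z w) = (\<Prod>k<n. exp (- L k w))"
      unfolding Z_def by (simp add: exp_sum flip: sum_negf)
    also have "\<dots> = shear_lik f v n w"
      unfolding shear_lik_def L_def using elim
      by (intro prod.cong) (auto simp: exp_minus)
    finally show ?case by simp
  qed
  \<comment> \<open>The change of measure applied to the constant 1 bounds this exponential moment
    by 1.\<close>
  have "(\<integral>\<^sup>+w. ennreal (exp (- Z w)) \<partial>P) = (\<integral>\<^sup>+w. 1 * ennreal (shear_lik f v n w) \<partial>P)"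
    using lik by (intro nn_integral_cong_AE) auto
  also have "\<dots> \<le> (\<integral>\<^sup>+w. 1 \<partial>P)"
    by (rule nn_integral_shear_le[where F = "\<lambda>_. 1"]) (use adapted in auto)
  finally have le1: "(\<integral>\<^sup>+w. ennreal (exp (- Z w)) \<partial>P) \<le> ennreal 1" by simp
  have [measurable]: "Z \<in> borel_measurable P" using intZ by auto
  have intE: "integrable P (\<lambda>w. exp (- Z w))"
    using le1 by (intro integrableI_nonneg) (auto intro: order_le_less_trans)
  have E1: "(\<integral>w. exp (- Z w) \<partial>P) \<le> 1"
    using le1 nn_integral_eq_integral[OF intE] by simp
  have pos: "0 \<le> Z w + exp (- Z w)" for w
    using exp_ge_add_one_self[of "- Z w"] by simp
  \<comment> \<open>A ratio below \<open>exp (- K)\<close> means \<open>Z w > K\<close>, and the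
    added exponential only increases the sum.\<close>
  have "measure P {w \<in> space P. shear_lik f v n w < exp (- K)} \<le> measure P {w \<in> space P. Z w + exp (- Z w) \<ge> K}"
  proof (rule P.finite_measure_mono_AE)
    show "AE w in P. w \<in> {w \<in> space P. shear_lik f v n w < exp (- K)} \<longrightarrow> w \<in> {w \<in> space P. Z w + exp (- Z w) \<ge> K}"
      using lik
    proof eventually_elim
      case (elim w)
      then show ?case using exp_ge_zero[of "- Z w"] by (auto simp del: exp_ge_zero)
    qed
  qed measurable
  also have "\<dots> \<le> (\<integral>w. Z w + exp (- Z w) \<partial>P) / K"
    using intZ intE pos \<open>K > 0\<close> by (intro integral_Markov_inequality_measure[where A = "{}"]) auto
  also have "\<dots> \<le> (\<kappa> * (\<Sum>k<n. B (int (Suc k))) + 1) / K"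
    using intZ intE Zle E1 \<open>K > 0\<close> by (intro divide_right_mono) auto
  finally show ?thesis .
qed

text \<open>X_t is the innovation \<open>w t\<close> translated by a quantity determined by the
  past, and the assumed bound is uniform in translations.\<close>

lemma ar_small_ball:
  assumes "\<And>t. t \<le> 0 \<Longrightarrow> a t = 0" and ball: "\<And>y. emeasure \<psi> {u. \<bar>y + u\<bar> \<le> \<eta>} \<le> ennreal (1/2)"
  shows "measure P {w \<in> space P. \<bar>ar a w t\<bar> \<le> \<eta>} \<le> 1/2"
proof -
  interpret P: prob_space P by (rule prob_P)
  have "emeasure P {w \<in> space P. \<bar>ar a w t\<bar> \<le> \<eta>} = (\<integral>\<^sup>+w. indicator {w \<in> space P. \<bar>ar a w t\<bar> \<le> \<eta>} w \<partial>P)"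
    by (rule nn_integral_indicator[symmetric]) measurable
  also have "\<dots> = (\<integral>\<^sup>+w. (\<integral>\<^sup>+u. indicator {w \<in> space P. \<bar>ar a w t\<bar> \<le> \<eta>} (w(t := u)) \<partial>\<psi>) \<partial>P)"
    by (rule nn_integral_resample) measurable
  also have "\<dots> = (\<integral>\<^sup>+w. (\<integral>\<^sup>+u. indicator {u. \<bar>a t * ar a w (t - 1) + u\<bar> \<le> \<eta>} u \<partial>\<psi>) \<partial>P)"
  proof (intro nn_integral_cong)
    fix w u
    have "ar a (w(t := u)) t = a t * ar a w (t - 1) + u"
      using ar_rec[of a "w(t := u)" t] assms(1) by (simp add: ar_update_future)
    then show "indicator {w \<in> space P. \<bar>ar a w t\<bar> \<le> \<eta>} (w(t := u))
        = (indicator {u. \<bar>a t * ar a w (t - 1) + u\<bar> \<le> \<eta>} u :: ennreal)"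
      by (simp add: indicator_def)
  qed
  also have "\<dots> \<le> (\<integral>\<^sup>+w. ennreal (1/2) \<partial>P)"
    using ball by (intro nn_integral_mono) simp
  also have "\<dots> = ennreal (1/2)"
    by (simp only: nn_integral_const space_P emeasure_P_UNIV mult_1_right)
  finally have "ennreal (measure P {w \<in> space P. \<bar>ar a w t\<bar> \<le> \<eta>}) \<le> ennreal (1/2)"
    by (simp only: P.emeasure_eq_measure)
  then show ?thesis
    by (subst (asm) ennreal_le_iff) auto
qed

text \<open>The shift compensates the change of coefficient, so the path of \<open>a\<close> also
  solves the recursion for \<open>a'\<close> driven by the sheared innovations.\<close>

lemma ar_shear:
  assumes "\<And>t. t \<le> 0 \<Longrightarrow> a t = 0" and "\<And>t. t \<le> 0 \<Longrightarrow> a' t = 0" and "t \<le> int n"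
  shows "ar a' (shear (\<lambda>s w. (a s - a' s) * ar a w (s - 1)) n w) t = ar a w t"
proof (rule ar_unique[OF assms(2), symmetric])
  fix s assume "s \<le> int n"
  then show "ar a w s = a' s * ar a w (s - 1) + shear (\<lambda>s w. (a s - a' s) * ar a w (s - 1)) n w s"
    using ar_rec[of a w s] assms(1,2) by (auto simp: shear_def algebra_simps)
qed (use assms in auto)

text \<open>Le Cam's two-point argument. The shear makes both processes follow one path, so the
  predictor returns one value \<open>y\<close>, which cannot be close to both \<open>a t * x\<close>
  and \<open>a' t * x\<close> unless \<open>x\<close> is small. \<open>D\<close> acts as a bound on
  the relative entropy.\<close>

lemma two_point_bound:
  assumes a: "\<And>t. t \<le> 0 \<Longrightarrow> a t = 0" "\<And>t. \<bar>a t\<bar> \<le> \<delta>" and a': "\<And>t. t \<le> 0 \<Longrightarrow> a' t = 0"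
    and "\<delta> < 1" and "\<eta> > 0" and ball: "\<And>y. emeasure \<psi> {u. \<bar>y + u\<bar> \<le> \<eta>} \<le> ennreal (1/2)"
    and D: "\<kappa> * (\<Sum>k<n. (a (int (Suc k)) - a' (int (Suc k)))\<^sup>2 * (1 / (1 - \<delta>\<^sup>2))) \<le> D" "0 \<le> D"
    and t: "1 \<le> t" "t \<le> int n" and [measurable]: "g \<in> borel_measurable (\<Pi>\<^sub>M s\<in>{..t - 1}. borel)"
  defines "e \<equiv> \<lambda>a. \<integral>\<^sup>+w. ennreal ((g (\<lambda>s\<in>{..t-1}. ar a w s) - a t * ar a w (t - 1))\<^sup>2) \<partial>P"
  shows "ennreal (exp (- (4 * (D + 1))) * \<eta>\<^sup>2 / 8 * (a t - a' t)\<^sup>2) \<le> e a + e a'"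
proof -
  interpret P: prob_space P by (rule prob_P)
  define v where "v = (\<lambda>s w. (a s - a' s) * ar a w (s - 1))"
  \<comment> \<open>Turns the Markov bound \<open>(D + 1) / K\<close> into 1/4.\<close>
  define K where "K = 4 * (D + 1)"
  \<comment> \<open>The 2 comes from the inequality (p - q)^2 <= 2 (p^2 + q^2); the probability 1/4
    of \<open>E\<close> makes it the 8 of the statement.\<close>
  define c where "c = exp (- K) * \<eta>\<^sup>2 / 2 * (a t - a' t)\<^sup>2"
  have K: "K > 0" using D by (simp add: K_def)
  have d1: "\<delta>\<^sup>2 < 1" using a(2)[of 0] \<open>\<delta> < 1\<close> by (intro abs_square_less_1[THEN iffD2]) auto
  have mv[measurable]: "v s \<in> borel_measurable P" for s
    unfolding v_def by measurable
  have adapted: "v s (w(t := u)) = v s w" if "s \<le> t" for s t w u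
    using that by (simp add: v_def ar_update_future)
  have [measurable]: "(\<lambda>w. g (\<lambda>s\<in>{..t-1}. ar b w s)) \<in> borel_measurable P" for b
    by (rule measurable_compose[of _ _ "\<Pi>\<^sub>M s\<in>{..t - 1}. borel"], rule measurable_restrict) auto
  define F where "F = (\<lambda>b w. ennreal ((g (\<lambda>s\<in>{..t-1}. ar b w s) - b t * ar b w (t - 1))\<^sup>2))"
  have mF[measurable]: "F b \<in> borel_measurable P" for b
    unfolding F_def by measurable
  \<comment> \<open>Up to time \<open>t - 1\<close> the process of \<open>a'\<close> after the shear
    is the process of \<open>a\<close>, so both errors contain the same predicted value.\<close>
  have Fa': "F a' (shear v n w) = ennreal ((g (\<lambda>s\<in>{..t-1}. ar a w s) - a' t * ar a w (t - 1))\<^sup>2)" for w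
  proof -
    have "ar a' (shear v n w) s = ar a w s" if "s \<le> t - 1" for s
      unfolding v_def using that t by (intro ar_shear a a') auto
    then show ?thesis
      unfolding F_def by (simp cong: restrict_cong)
  qed
  define E where "E = {w \<in> space P. \<bar>ar a w (t - 1)\<bar> > \<eta> \<and> shear_lik f v n w \<ge> exp (- K)}"
  have [measurable]: "E \<in> sets P" unfolding E_def by measurable
  have B: "(\<integral>\<^sup>+w. ennreal ((v s w)\<^sup>2) \<partial>P) \<le> ennreal ((a s - a' s)\<^sup>2 * (1 / (1 - \<delta>\<^sup>2)))" for s
  proof -
    have "(\<integral>\<^sup>+w. ennreal ((v s w)\<^sup>2) \<partial>P) = ennreal ((a s - a' s)\<^sup>2) * (\<integral>\<^sup>+w. ennreal ((ar a w (s - 1))\<^sup>2) \<partial>P)"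
      unfolding v_def by (simp add: power_mult_distrib ennreal_mult nn_integral_cmult)
    also have "\<dots> \<le> ennreal ((a s - a' s)\<^sup>2) * ennreal (1 / (1 - \<delta>\<^sup>2))"
      by (intro mult_left_mono ar_second_moment a \<open>\<delta> < 1\<close>) auto
    finally show ?thesis using d1 by (simp add: ennreal_mult[symmetric])
  qed
  have "measure P {w \<in> space P. shear_lik f v n w < exp (- K)}
      \<le> (\<kappa> * (\<Sum>k<n. (a (int (Suc k)) - a' (int (Suc k)))\<^sup>2 * (1 / (1 - \<delta>\<^sup>2))) + 1) / K"
    using d1 by (intro shear_lik_small_prob mv adapted B K) auto
  also have "\<dots> \<le> (D + 1) / K"
    using D K by (intro divide_right_mono) auto
  also have "\<dots> = 1/4" using D by (simp add: K_def field_simps)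
  finally have p1: "measure P {w \<in> space P. shear_lik f v n w < exp (- K)} \<le> 1/4" .
  have p2: "measure P {w \<in> space P. \<bar>ar a w (t - 1)\<bar> \<le> \<eta>} \<le> 1/2"
    by (intro ar_small_ball a ball)
  have m12: "{w \<in> space P. shear_lik f v n w < exp (- K)} \<in> sets P"
      "{w \<in> space P. \<bar>ar a w (t - 1)\<bar> \<le> \<eta>} \<in> sets P"
    by measurable
  have "1 - measure P E = measure P (space P - E)"
    by (rule P.prob_compl[symmetric]) measurable
  also have "\<dots> \<le> measure P ({w \<in> space P. shear_lik f v n w < exp (- K)} \<union> {w \<in> space P. \<bar>ar a w (t - 1)\<bar> \<le> \<eta>})"
    by (intro P.finite_measure_mono) (use m12 in \<open>auto simp: E_def\<close>)
  also have "\<dots> \<le> 1/4 + 1/2"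
    using p1 p2 m12 by (intro order_trans[OF measure_Un_le]) auto
  finally have pE: "1/4 \<le> measure P E" by simp
  \<comment> \<open>On \<open>E\<close> the likelihood ratio is at least \<open>exp (- K)\<close>,
    so both squared errors keep at least this weight, and the difference of the two errors has
    modulus at least \<open>\<eta> * \<bar>a t - a' t\<bar>\<close>.\<close>
  have point: "ennreal c * indicator E w \<le> F a w + F a' (shear v n w) * ennreal (shear_lik f v n w)" for w
  proof (cases "w \<in> E")
    case True
    define x where "x = ar a w (t - 1)"
    define y where "y = g (\<lambda>s\<in>{..t-1}. ar a w s)"
    define l where "l = shear_lik f v n w"
    have l: "exp (- K) \<le> l" "0 \<le> l" using True shear_lik_nonneg by (auto simp: E_def l_def)
    have e: "exp (- K) \<le> 1" using K by simp
    have "\<eta>\<^sup>2 \<le> x\<^sup>2" using True \<open>\<eta> > 0\<close> by (auto simp: E_def x_def abs_le_square_iff[symmetric])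
    then have "\<eta>\<^sup>2 * (a t - a' t)\<^sup>2 \<le> x\<^sup>2 * (a t - a' t)\<^sup>2"
      by (intro mult_right_mono) auto
    also have "\<dots> \<le> 2 * ((y - a t * x)\<^sup>2 + (y - a' t * x)\<^sup>2)"
      using zero_le_power2[of "(y - a t * x) + (y - a' t * x)"] by (simp add: power2_eq_square algebra_simps)
    finally have "\<eta>\<^sup>2 / 2 * (a t - a' t)\<^sup>2 \<le> (y - a t * x)\<^sup>2 + (y - a' t * x)\<^sup>2" by simp
    then have "exp (- K) * (\<eta>\<^sup>2 / 2 * (a t - a' t)\<^sup>2) \<le> exp (- K) * ((y - a t * x)\<^sup>2 + (y - a' t * x)\<^sup>2)"
      by (intro mult_left_mono) auto
    also have "\<dots> \<le> 1 * (y - a t * x)\<^sup>2 + l * (y - a' t * x)\<^sup>2"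
      unfolding distrib_left using l e by (intro add_mono mult_right_mono) auto
    finally have "c \<le> (y - a t * x)\<^sup>2 + (y - a' t * x)\<^sup>2 * l"
      by (simp add: c_def mult_ac)
    then have "ennreal c \<le> ennreal ((y - a t * x)\<^sup>2 + (y - a' t * x)\<^sup>2 * l)"
      by (rule ennreal_leI)
    then show ?thesis
      using True l unfolding Fa' unfolding F_def x_def[symmetric] y_def[symmetric] l_def[symmetric]
      by (simp add: ennreal_plus ennreal_mult)
  qed simp
  have "ennreal (exp (- (4 * (D + 1))) * \<eta>\<^sup>2 / 8 * (a t - a' t)\<^sup>2) = ennreal (c * (1/4))"
    by (simp add: c_def K_def)
  also have "\<dots> \<le> ennreal (c * measure P E)"
    using pE by (intro ennreal_leI mult_left_mono) (auto simp: c_def)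
  also have "\<dots> = (\<integral>\<^sup>+w. ennreal c * indicator E w \<partial>P)"
    by (subst nn_integral_cmult_indicator) (simp_all add: P.emeasure_eq_measure ennreal_mult'')
  also have "\<dots> \<le> (\<integral>\<^sup>+w. F a w + F a' (shear v n w) * ennreal (shear_lik f v n w) \<partial>P)"
    by (rule nn_integral_mono) (rule point)
  also have "\<dots> = (\<integral>\<^sup>+w. F a w \<partial>P) + (\<integral>\<^sup>+w. F a' (shear v n w) * ennreal (shear_lik f v n w) \<partial>P)"
    using measurable_compose[OF measurable_shear[OF mv] mF] measurable_shear_lik[OF mv]
    by (intro nn_integral_add mF borel_measurable_times) simp_all
  \<comment> \<open>The weighted error along the sheared path is traded for the plain error under
    \<open>a'\<close>.\<close>
  also have "\<dots> \<le> (\<integral>\<^sup>+w. F a w \<partial>P) + (\<integral>\<^sup>+w. F a' w \<partial>P)"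
    by (intro add_left_mono nn_integral_shear_le mv adapted mF)
  also have "\<dots> = e a + e a'"
    unfolding F_def e_def ..
  finally show ?thesis .
qed

end

section \<open>Polynomial bumps\<close>

text \<open>The family is closed under differentiation with \<open>S\<close> unchanged, as long as
  \<open>p\<close> and its derivative vanish at 0 and 1.\<close>

definition tile :: "int set \<Rightarrow> real poly \<Rightarrow> real \<Rightarrow> real" where
  "tile S p x = (if \<lfloor>x\<rfloor> \<in> S then poly p (x - of_int \<lfloor>x\<rfloor>) else 0)"

text \<open>The polynomial x(1 - x) to the power \<open>N\<close>: vanishing to order
  \<open>N\<close> at both ends suffices for finitely many derivatives.\<close>

definition bump_poly :: "nat \<Rightarrow> real poly" where
  "bump_poly N = [:0, 1, -1:] ^ N"

lemma tile_empty[simp]: "tile {} p x = 0"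
  by (simp add: tile_def)

text \<open>The right end of a closed cell has its floor in the next cell, but both formulas give 0
  there. Closed cells are what gluing one-sided derivatives requires.\<close>

lemma tile_eq:
  assumes "poly p 0 = 0" "poly p 1 = 0" and "x \<in> {of_int n..of_int n + 1}"
  shows "tile S p x = (if n \<in> S then poly p (x - of_int n) else 0)"
proof (cases "x = of_int n + 1")
  case True
  then have "x = of_int (n + 1)" by simp
  then have "\<lfloor>x\<rfloor> = n + 1" by (simp only: floor_of_int)
  with True show ?thesis using assms by (simp add: tile_def)
next
  case False
  with assms(3) have "\<lfloor>x\<rfloor> = n" by (intro floor_unique) auto
  then show ?thesis by (simp add: tile_def)
qed

text \<open>The function is polynomial on each closed cell. At an integer the derivatives within the
  two adjacent cells are both 0, and the union of these cells is a neighbourhood.\<close>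

lemma tile_has_derivative:
  assumes p: "poly p 0 = 0" "poly p 1 = 0" and p': "poly (pderiv p) 0 = 0" "poly (pderiv p) 1 = 0"
  shows "(tile S p has_real_derivative tile S (pderiv p) x) (at x)"
proof -
  have within: "(tile S p has_real_derivative tile S (pderiv p) x) (at x within {of_int n..of_int n + 1})"
    if x: "x \<in> {of_int n..of_int n + 1}" for n
  proof -
    have "((\<lambda>x. if n \<in> S then poly p (x - of_int n) else 0) has_real_derivative
        (if n \<in> S then poly (pderiv p) (x - of_int n) else 0)) (at x within {of_int n..of_int n + 1})"
      by (auto intro!: derivative_eq_intros DERIV_chain'[where g = "poly p"] poly_DERIV)
    then show ?thesis
      unfolding tile_eq[OF p' x] has_field_derivative_def
      by (rule has_derivative_transform[OF x tile_eq[OF p], rotated])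
  qed
  define n where "n = \<lfloor>x\<rfloor>"
  have n: "of_int n \<le> x" "x < of_int n + 1" by (auto simp: n_def)
  show ?thesis
  proof (cases "x = of_int n")
    case False
    with n have "x \<in> interior {of_int n..of_int n + 1}" by auto
    moreover have "x \<in> {of_int n..of_int n + 1}" using n by auto
    ultimately show ?thesis using within[of n] by (simp only: at_within_interior)
  next
    case True
    let ?A = "{of_int (n - 1)..of_int (n - 1) + 1}" and ?B = "{of_int n..of_int n + 1}"
    have "(tile S p has_real_derivative tile S (pderiv p) x) (at x within ?A \<union> ?B)"
      using within[of "n - 1"] within[of n] True unfolding has_field_derivative_iff
      by (intro Lim_Un) auto
    moreover have "?A \<union> ?B = {of_int n - 1..of_int n + (1 :: real)}" by auto
    moreover have "x \<in> interior {of_int n - 1..of_int n + (1 :: real)}" using True by auto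
    ultimately show ?thesis by (simp only: at_within_interior)
  qed
qed

lemma tile_bounded: obtains M where "M > 0" and "\<And>S x. \<bar>tile S p x\<bar> \<le> M"
proof -
  have "compact (poly p ` {0..1})"
    by (intro compact_continuous_image continuous_intros compact_Icc)
  then have "bounded (poly p ` {0..1})" by (rule compact_imp_bounded)
  then obtain M where M: "M > 0" "\<And>x. x \<in> {0..1} \<Longrightarrow> \<bar>poly p x\<bar> \<le> M"
    unfolding bounded_pos by auto
  have "\<bar>tile S p x\<bar> \<le> M" for S x
    using M(1) M(2)[of "x - of_int \<lfloor>x\<rfloor>"] floor_correct[of x] by (auto simp: tile_def less_imp_le)
  with M(1) show thesis by (rule that)
qed

text \<open>Points at distance at most 1 are handled by the derivative bound, since there
  \<open>\<bar>x - y\<bar> \<le> \<bar>x - y\<bar> powr \<alpha>\<close>, and farther points by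
  boundedness. One \<open>C\<close> serves all patterns \<open>S\<close>.\<close>

lemma tile_hoelder:
  assumes p: "poly p 0 = 0" "poly p 1 = 0" and p': "poly (pderiv p) 0 = 0" "poly (pderiv p) 1 = 0"
    and \<alpha>: "0 < \<alpha>" "\<alpha> \<le> 1"
  obtains C where "C > 0" and "\<And>S x y. \<bar>tile S p x - tile S p y\<bar> \<le> C * \<bar>x - y\<bar> powr \<alpha>"
proof -
  obtain M where M: "M > 0" "\<And>S x. \<bar>tile S p x\<bar> \<le> M" by (rule tile_bounded[of p]) blast
  obtain M' where M': "M' > 0" "\<And>S x. \<bar>tile S (pderiv p) x\<bar> \<le> M'" by (rule tile_bounded[of "pderiv p"]) blast
  have "\<bar>tile S p x - tile S p y\<bar> \<le> (2 * M + M') * \<bar>x - y\<bar> powr \<alpha>" for S x y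
  proof (cases "\<bar>x - y\<bar> \<le> 1")
    case True
    have "\<bar>tile S p x - tile S p y\<bar> \<le> M' * \<bar>x - y\<bar>"
      using field_differentiable_bound[of UNIV "tile S p" "tile S (pderiv p)" M' x y]
        tile_has_derivative[OF p p'] M' by auto
    also have "\<bar>x - y\<bar> \<le> \<bar>x - y\<bar> powr \<alpha>"
      using powr_mono'[of \<alpha> 1 "\<bar>x - y\<bar>"] True \<alpha> by (cases "x = y") auto
    then have "M' * \<bar>x - y\<bar> \<le> (2 * M + M') * \<bar>x - y\<bar> powr \<alpha>"
      using M M' by (intro mult_mono) auto
    finally show ?thesis .
  next
    case False
    have "\<bar>tile S p x - tile S p y\<bar> \<le> (2 * M + M') * 1"
      using M(2)[of S x] M(2)[of S y] M'(1) abs_triangle_ineq4[of "tile S p x" "tile S p y"] by simp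
    also have "\<dots> \<le> (2 * M + M') * \<bar>x - y\<bar> powr \<alpha>"
      using False \<alpha> M M' by (intro mult_left_mono ge_one_powr_ge_zero) auto
    finally show ?thesis .
  qed
  then show thesis using M M' by (intro that[of "2 * M + M'"]) auto
qed

lemma pderiv_power_dvd:
  fixes p q :: "'a :: idom poly"
  assumes "q ^ Suc j dvd p"
  shows "q ^ j dvd pderiv p"
proof -
  from assms obtain r where "p = q ^ Suc j * r" by (elim dvdE)
  then have "pderiv p = q ^ Suc j * pderiv r + r * (smult (of_nat (Suc j)) (q ^ j) * pderiv q)"
    by (simp only: pderiv_mult pderiv_power_Suc)
  also have "\<dots> = q ^ j * (q * pderiv r + smult (of_nat (Suc j)) (pderiv q) * r)"
    by (simp add: algebra_simps)
  finally have "pderiv p = q ^ j * (q * pderiv r + smult (of_nat (Suc j)) (pderiv q) * r)" .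
  then show ?thesis by simp
qed

text \<open>Each derivative removes at most one factor x(1 - x), so one is left after
  \<open>i < N\<close> derivatives.\<close>

lemma bump_poly_pderiv_zero:
  assumes "i < N"
  shows "poly ((pderiv ^^ i) (bump_poly N)) 0 = 0" and "poly ((pderiv ^^ i) (bump_poly N)) 1 = 0"
proof -
  have "[:0, 1, -1:] ^ (N - i) dvd (pderiv ^^ i) (bump_poly N)"
    using assms
  proof (induction i)
    case (Suc i)
    then have "[:0, 1, -1:] ^ Suc (N - Suc i) dvd (pderiv ^^ i) (bump_poly N)"
      by (simp add: Suc_diff_Suc)
    then show ?case by (simp only: funpow.simps comp_def pderiv_power_dvd)
  qed (simp add: bump_poly_def)
  then have "[:0, 1, -1:] dvd (pderiv ^^ i) (bump_poly N)"
    using assms by (metis dvd_power dvd_trans zero_less_diff)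
  then show "poly ((pderiv ^^ i) (bump_poly N)) 0 = 0" "poly ((pderiv ^^ i) (bump_poly N)) 1 = 0"
    by (auto elim!: dvdE)
qed

lemma bump_poly_tile_bounds: "0 \<le> tile S (bump_poly N) x" "tile S (bump_poly N) x \<le> 1"
proof -
  define y where "y = x - of_int \<lfloor>x\<rfloor>"
  have y: "0 \<le> y" "y \<le> 1" unfolding y_def by linarith+
  then have "0 \<le> y - y * y" "y - y * y \<le> 1"
    using mult_left_le[of y y] by (auto intro: order_trans[of _ y])
  then have "0 \<le> (y - y * y) ^ N" "(y - y * y) ^ N \<le> 1" by (auto intro: power_le_one)
  then show "0 \<le> tile S (bump_poly N) x" "tile S (bump_poly N) x \<le> 1"
    by (auto simp: tile_def bump_poly_def poly_power algebra_simps y_def)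
qed

text \<open>\<open>vector_derivative\<close> within \<open>{..b}\<close> is a choice operator; it is
  pinned down because every \<open>s \<le> b\<close>, the endpoint included, is a limit point of
  \<open>{..b}\<close>.\<close>

lemma nderiv_on_eq:
  assumes "\<And>i s. i < k \<Longrightarrow> (F i has_real_derivative F (Suc i) s) (at s)"
  shows "i \<le> k \<Longrightarrow> s \<le> b \<Longrightarrow> nderiv_on {..b} i (F 0) s = F i s"
proof (induction i arbitrary: s)
  case (Suc i)
  have "(F i has_vector_derivative F (Suc i) s) (at s within {..b})"
    using assms[of i s] Suc.prems by (simp add: has_real_derivative_iff_has_vector_derivative has_vector_derivative_at_within)
  then have "(nderiv_on {..b} i (F 0) has_vector_derivative F (Suc i) s) (at s within {..b})"
    by (rule has_vector_derivative_transform[rotated 2]) (use Suc in auto)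
  moreover have "at s within {..b} \<noteq> bot"
  proof -
    have "s islimpt {s - 1..s}" by (simp add: islimpt_Icc)
    then have "s islimpt {..b}" by (rule islimpt_subset) (use Suc.prems in auto)
    then show ?thesis by (simp add: trivial_limit_within)
  qed
  ultimately show ?case by (simp add: vector_derivative_within)
qed simp

lemma times_differentiable_on_if_derivatives:
  assumes "\<And>i s. i < k \<Longrightarrow> (F i has_real_derivative F (Suc i) s) (at s)"
  shows "times_differentiable_on k (F 0) {..b}"
  unfolding times_differentiable_on_def differentiable_on_def
proof (intro allI impI ballI)
  fix i s assume i: "i < k" and s: "s \<in> {..b}"
  have diff: "F i differentiable (at s within {..b})"
    using assms[OF i, of s] by (meson differentiable_at_withinI real_differentiable_def)
  have eq: "nderiv_on {..b} i (F 0) s = F i s" if "s \<le> b" for s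
    by (rule nderiv_on_eq[of k F]) (use assms i that in auto)
  show "nderiv_on {..b} i (F 0) differentiable (at s within {..b})"
    by (rule differentiable_transform_within[OF diff, of 1])
       (use eq i s in auto)
qed

text \<open>Cells have width \<open>1 / \<mu>\<close>; with \<open>\<mu> = T / q\<close> each covers
  \<open>q\<close> observation times.\<close>

definition bump_coeff :: "nat \<Rightarrow> real \<Rightarrow> real \<Rightarrow> int set \<Rightarrow> real \<Rightarrow> real" where
  "bump_coeff N h \<mu> S u = h * tile S (bump_poly N) (\<mu> * u)"

lemma bump_coeff_empty[simp]: "bump_coeff N h \<mu> {} u = 0"
  by (simp add: bump_coeff_def)

text \<open>By scaling, derivative \<open>k\<close> is \<open>h * \<mu> ^ k\<close> times a tiled
  polynomial, so its seminorm of order \<open>\<alpha>\<close> is at most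
  \<open>C * h * \<mu> powr (k + \<alpha>)\<close>. \<open>C\<close> and \<open>N\<close> are fixed
  before pattern, height and scale.\<close>

lemma bump_coeff_holder_ball:
  assumes "d \<ge> 1" and "\<beta> > 0"
  obtains C N where "C > 0" and "N > 0" and
    "\<And>S h \<mu> R. 0 \<le> h \<Longrightarrow> 0 < \<mu> \<Longrightarrow> C * h * \<mu> powr \<beta> \<le> R \<Longrightarrow>
      (\<lambda>u j. if j = 1 then bump_coeff N h \<mu> S u else 0) \<in> holder_ball d \<beta> R"
proof -
  define k where "k = nat (\<lceil>\<beta>\<rceil> - 1)"
  define \<alpha> where "\<alpha> = \<beta> - real k"
  \<comment> \<open>The Hoelder bound for derivative \<open>k\<close> requires derivatives
    \<open>k\<close> and \<open>k + 1\<close> to vanish at the ends of a cell.\<close>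
  define N where "N = k + 2"
  have "real k = of_int \<lceil>\<beta>\<rceil> - 1" using \<open>\<beta> > 0\<close> by (simp add: k_def)
  then have \<alpha>: "0 < \<alpha>" "\<alpha> \<le> 1" unfolding \<alpha>_def by linarith+
  define p where "p = (pderiv ^^ k) (bump_poly N)"
  have p0: "poly p 0 = 0" "poly p 1 = 0" "poly (pderiv p) 0 = 0" "poly (pderiv p) 1 = 0"
    using bump_poly_pderiv_zero[of k N] bump_poly_pderiv_zero[of "Suc k" N] by (auto simp: p_def N_def)
  obtain C where C: "C > 0" "\<And>S x y. \<bar>tile S p x - tile S p y\<bar> \<le> C * \<bar>x - y\<bar> powr \<alpha>"
    by (rule tile_hoelder[OF p0 \<alpha>]) blast
  show thesis
  proof (rule that[OF C(1), of N])
    show "N > 0" by (simp add: N_def)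
  next
    fix S h \<mu> R assume h: "0 \<le> (h :: real)" and \<mu>: "0 < (\<mu> :: real)" and R: "C * h * \<mu> powr \<beta> \<le> R"
    define F where "F S i u = h * \<mu> ^ i * tile S ((pderiv ^^ i) (bump_poly N)) (\<mu> * u)" for S i u
    define \<theta> where "\<theta> = (\<lambda>u j. if j = (1::nat) then bump_coeff N h \<mu> S u else 0)"
    \<comment> \<open>Zero coordinates are bumps with empty pattern, so one family \<open>F\<close>
      serves all \<open>j\<close>.\<close>
    have \<theta>: "(\<lambda>s. \<theta> s j) = F (if j = 1 then S else {}) 0" for j
      by (auto simp: \<theta>_def F_def bump_coeff_def)
    have F: "(F S' i has_real_derivative F S' (Suc i) s) (at s)" if "i < k" for S' i s
    proof -
      have "(tile S' ((pderiv ^^ i) (bump_poly N)) has_real_derivative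
          tile S' ((pderiv ^^ Suc i) (bump_poly N)) (\<mu> * s)) (at (\<mu> * s))"
        using that bump_poly_pderiv_zero[of i N] bump_poly_pderiv_zero[of "Suc i" N] tile_has_derivative
        by (simp add: N_def)
      then show ?thesis
        unfolding F_def by (auto intro!: derivative_eq_intros DERIV_chain'[where g = "tile S' _"])
    qed
    have td: "times_differentiable_on k (\<lambda>s. \<theta> s j) {..1}" for j
      unfolding \<theta> by (rule times_differentiable_on_if_derivatives) (rule F)
    have nd: "nderiv_on {..1} k (\<lambda>s. \<theta> s j) u = F (if j = 1 then S else {}) k u" if "u \<le> 1" for j u
      unfolding \<theta> by (rule nderiv_on_eq[of k]) (use F that in auto)
    have "holder_seminorm_le1 d {..1} \<alpha> (\<lambda>s j. nderiv_on {..1} k (\<lambda>u. \<theta> u j) s) \<le> ennreal R"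
      unfolding holder_seminorm_le1_def
    proof (rule SUP_least, clarsimp)
      fix s s' :: real assume s: "s \<le> 1" "s' \<le> 1" "s \<noteq> s'"
      \<comment> \<open>At most one coordinate is nonzero, so passing to the sum of absolute values
        costs nothing.\<close>
      have "L2_set (\<lambda>j. nderiv_on {..1} k (\<lambda>u. \<theta> u j) s - nderiv_on {..1} k (\<lambda>u. \<theta> u j) s') {1..d}
          \<le> (\<Sum>j=1..d. \<bar>nderiv_on {..1} k (\<lambda>u. \<theta> u j) s - nderiv_on {..1} k (\<lambda>u. \<theta> u j) s'\<bar>)"
        by (rule L2_set_le_sum_abs)
      also have "\<dots> = (\<Sum>j=1..d. if j = 1 then \<bar>F S k s - F S k s'\<bar> else 0)"
        using s by (intro sum.cong) (auto simp: nd F_def)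
      also have "\<dots> = \<bar>F S k s - F S k s'\<bar>"
        using \<open>d \<ge> 1\<close> by simp
      also have "\<dots> = h * \<mu> ^ k * \<bar>tile S p (\<mu> * s) - tile S p (\<mu> * s')\<bar>"
        using h \<mu> by (simp add: F_def p_def abs_mult right_diff_distrib[symmetric])
      also have "\<dots> \<le> h * \<mu> ^ k * (C * \<bar>\<mu> * s - \<mu> * s'\<bar> powr \<alpha>)"
        using h \<mu> by (intro mult_left_mono C) auto
      also have "\<bar>\<mu> * s - \<mu> * s'\<bar> powr \<alpha> = \<mu> powr \<alpha> * \<bar>s - s'\<bar> powr \<alpha>"
        using \<mu> by (simp add: right_diff_distrib[symmetric] abs_mult powr_mult)
      also have "h * \<mu> ^ k * (C * (\<mu> powr \<alpha> * \<bar>s - s'\<bar> powr \<alpha>)) = C * h * \<mu> powr \<beta> * \<bar>s - s'\<bar> powr \<alpha>"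
        using \<mu> by (simp add: \<alpha>_def powr_diff powr_realpow)
      also have "\<dots> \<le> R * \<bar>s - s'\<bar> powr \<alpha>"
        using R by (intro mult_right_mono) auto
      finally show "ennreal (L2_set (\<lambda>j. nderiv_on {..1} k (\<lambda>u. \<theta> u j) s - nderiv_on {..1} k (\<lambda>u. \<theta> u j) s') {Suc 0..d}
          / \<bar>s - s'\<bar> powr \<alpha>) \<le> ennreal R"
        using s by (intro ennreal_leI) (simp add: divide_le_eq)
    qed
    with td show "(\<lambda>u j. if j = 1 then bump_coeff N h \<mu> S u else 0) \<in> holder_ball d \<beta> R"
      unfolding holder_ball_def holder_seminorm_def k_def[symmetric] Let_def \<alpha>_def[symmetric] \<theta>_def[symmetric]
      by simp
  qed
qed

lemma bump_coeff_bounds: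
  assumes "0 \<le> h"
  shows "0 \<le> bump_coeff N h \<mu> S u" and "bump_coeff N h \<mu> S u \<le> h"
  using assms bump_poly_tile_bounds[of S N "\<mu> * u"]
  by (simp_all add: bump_coeff_def mult_left_le)

text \<open>Supplies the zero coefficient at nonpositive times that \<open>tvar_law_ar\<close> asks
  for; \<open>N > 0\<close> settles \<open>u = 0\<close>, where cell 0 begins.\<close>

lemma bump_coeff_nonpos:
  assumes "N > 0" and "S \<subseteq> {0..}" and "0 < \<mu>" and "u \<le> 0"
  shows "bump_coeff N h \<mu> S u = 0"
proof (cases "u = 0")
  case True
  then show ?thesis using assms by (simp add: bump_coeff_def tile_def bump_poly_def poly_power)
next
  case False
  then have "\<mu> * u < 0" using assms by (simp add: mult_pos_neg)
  then have "\<lfloor>\<mu> * u\<rfloor> < 0" by simp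
  then show ?thesis using assms by (auto simp: bump_coeff_def tile_def)
qed

text \<open>The polynomial is 1 - \<open>\<phi> u\<close> z, and the product has modulus below
  \<open>\<delta> * inverse \<delta> = 1\<close>.\<close>

lemma stable_class_order_one:
  assumes "d \<ge> 1" and "0 < \<delta>" and "\<And>u. \<bar>\<phi> u\<bar> \<le> \<delta>"
  shows "(\<lambda>u j. if j = 1 then \<phi> u else 0) \<in> stable_class d \<delta>"
proof -
  have "tv_poly d (\<lambda>u j. if j = 1 then \<phi> u else 0) z u \<noteq> 0" if z: "cmod z < inverse \<delta>" for z u
  proof
    have "(\<Sum>j=1..d. complex_of_real (if j = 1 then \<phi> u else 0) * z ^ j)
        = (\<Sum>j=1..d. if j = 1 then complex_of_real (\<phi> u) * z else 0)"
      by (intro sum.cong) auto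
    also have "\<dots> = complex_of_real (\<phi> u) * z" using assms(1) by simp
    finally have eq: "tv_poly d (\<lambda>u j. if j = 1 then \<phi> u else 0) z u = 1 - complex_of_real (\<phi> u) * z"
      by (simp add: tv_poly_def)
    assume "tv_poly d (\<lambda>u j. if j = 1 then \<phi> u else 0) z u = 0"
    then have "1 - complex_of_real (\<phi> u) * z = 0" by (simp only: eq)
    then have "complex_of_real (\<phi> u) * z = 1" by simp
    then have "1 = \<bar>\<phi> u\<bar> * cmod z" by (metis norm_mult norm_of_real norm_one)
    also have "\<dots> \<le> \<delta> * cmod z" using assms(3) by (intro mult_right_mono) auto
    also have "\<dots> < 1" using z assms(2) by (simp add: field_simps)
    finally show False by simp
  qed
  then show ?thesis by (simp add: stable_class_def)
qed

section \<open>Averaging over the hypercube of bump patterns\<close>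

text \<open>The scaled time is \<open>(t - 1) / q\<close>; its floor and fractional part are
  quotient and remainder of integer division.\<close>

lemma bump_coeff_grid:
  assumes "q > 0" "T > 0"
  shows "bump_coeff N h (real T / real q) S (real_of_int (t - 1) / real T)
    = (if (t - 1) div int q \<in> S then h * poly (bump_poly N) (real_of_int ((t - 1) mod int q) / real q) else 0)"
proof -
  have eq: "real T / real q * (real_of_int (t - 1) / real T) = real_of_int (t - 1) / real_of_int (int q)"
    using assms by simp
  have fl: "\<lfloor>real_of_int (t - 1) / real_of_int (int q)\<rfloor> = (t - 1) div int q"
    by (rule floor_divide_of_int_eq)
  have "real_of_int (t - 1) = real_of_int (int q) * real_of_int ((t - 1) div int q) + real_of_int ((t - 1) mod int q)"
    by (metis mult_div_mod_eq of_int_add of_int_mult)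
  then have fr: "real_of_int (t - 1) / real_of_int (int q) - of_int ((t - 1) div int q)
      = real_of_int ((t - 1) mod int q) / real q"
    using assms by (simp add: field_simps)
  show ?thesis
    unfolding bump_coeff_def tile_def eq fl fr by simp
qed

text \<open>Flipping one bump changes the coefficient at no more than \<open>q\<close> times; with
  \<open>M = h\<^sup>2\<close> this controls the entropy between neighbouring patterns.\<close>

lemma sum_block_bound:
  fixes c :: "int \<Rightarrow> real"
  assumes "q > 0" and "\<And>t. 0 \<le> c t" and "\<And>t. c t \<le> M" and "\<And>t. (t - 1) div int q \<noteq> k \<Longrightarrow> c t = 0"
  shows "(\<Sum>j<T. c (int (Suc j))) \<le> real q * M"
proof -
  let ?A = "{j \<in> {..<T}. int j div int q = k}"
  have M: "0 \<le> M" using assms(2,3) order_trans by blast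
  have "(\<Sum>j<T. c (int (Suc j))) = (\<Sum>j\<in>?A. c (int (Suc j)))"
    by (rule sum.mono_neutral_right) (use assms(4) in auto)
  also have "\<dots> \<le> (\<Sum>j\<in>?A. M)"
    by (rule sum_mono) (rule assms(3))
  also have "\<dots> = real (card ?A) * M" by simp
  also have "card ?A \<le> q"
  proof -
    have "?A \<subseteq> {nat k * q..<nat k * q + q}"
    proof
      fix j assume "j \<in> ?A"
      then have "j div q = nat k" by (auto simp: zdiv_int[symmetric])
      moreover have "j = j div q * q + j mod q" by simp
      moreover have "j mod q < q" using assms(1) by simp
      ultimately show "j \<in> {nat k * q..<nat k * q + q}" by auto
    qed
    from card_mono[OF _ this] show ?thesis by simp
  qed
  then have "real (card ?A) * M \<le> real q * M"
    using M by (intro mult_right_mono) auto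
  finally show ?thesis .
qed

text \<open>At positions x between 1/4 and 1/2 of a block, x(1 - x) is at least 1/8, and at least
  \<open>q / 8\<close> indices of each block lie there.\<close>

lemma sum_bump_lower:
  assumes "q \<ge> 6" "0 \<le> h"
  shows "real m * (real q / 8) * (h\<^sup>2 * (1/64) ^ N)
    \<le> (\<Sum>r<m * q. (h * poly (bump_poly N) (real (r mod q) / real q))\<^sup>2)"
proof -
  define F where "F = (\<lambda>r. (h * poly (bump_poly N) (real (r mod q) / real q))\<^sup>2)"
  have F0: "0 \<le> F r" for r by (simp add: F_def)
  have low: "h\<^sup>2 * (1/64) ^ N \<le> F r" if r: "q \<le> 4 * (r mod q)" "2 * (r mod q) \<le> q" for r
  proof -
    define x where "x = real (r mod q) / real q"
    have x: "1/4 \<le> x" "x \<le> 1/2" using r assms(1) by (auto simp: x_def field_simps)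
    then have "1/4 * (1/2) \<le> x * (1 - x)" by (intro mult_mono) auto
    then have "1/8 \<le> x - x * x" by (simp add: algebra_simps)
    then have "(1/8) ^ N \<le> (x - x * x) ^ N" by (intro power_mono) auto
    then have "((1/8) ^ N)\<^sup>2 \<le> ((x - x * x) ^ N)\<^sup>2" by (rule power_mono) simp
    moreover have "((1/8 :: real) ^ N)\<^sup>2 = (1/64) ^ N"
      by (simp add: power_mult_distrib[symmetric] power2_eq_square)
    moreover have "poly (bump_poly N) x = (x - x * x) ^ N"
      by (simp add: bump_poly_def poly_power algebra_simps)
    ultimately show ?thesis
      unfolding F_def x_def[symmetric] power_mult_distrib by (intro mult_left_mono) auto
  qed
  define q' where "q' = q div 4"
  have q': "real q / 8 \<le> real q'" "2 * q' < q"
    using assms(1) unfolding q'_def by linarith+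
  have block: "real q / 8 * (h\<^sup>2 * (1/64) ^ N) \<le> sum F {k * q..<k * q + q}" for k
  proof -
    have "real q / 8 * (h\<^sup>2 * (1/64) ^ N) \<le> real q' * (h\<^sup>2 * (1/64) ^ N)"
      by (rule mult_right_mono[OF q'(1)]) simp
    also have "\<dots> = (\<Sum>r\<in>{k * q + q' + 1..<k * q + 2 * q' + 1}. h\<^sup>2 * (1/64) ^ N)"
      by simp
    also have "\<dots> \<le> sum F {k * q + q' + 1..<k * q + 2 * q' + 1}"
    proof (rule sum_mono)
      fix r assume r: "r \<in> {k * q + q' + 1..<k * q + 2 * q' + 1}"
      have "r = (r - k * q) + k * q" "r - k * q < q" using r q'(2) by auto
      then have "r mod q = r - k * q" by (metis mod_less mod_mult_self1)
      then have "q' + 1 \<le> r mod q" "r mod q \<le> 2 * q'" using r by auto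
      then show "h\<^sup>2 * (1/64) ^ N \<le> F r"
        unfolding q'_def by (intro low) linarith+
    qed
    also have "\<dots> \<le> sum F {k * q..<k * q + q}"
      using q'(2) F0 by (intro sum_mono2) auto
    finally show ?thesis .
  qed
  have "real m * (real q / 8) * (h\<^sup>2 * (1/64) ^ N) = (\<Sum>k<m. real q / 8 * (h\<^sup>2 * (1/64) ^ N))"
    by simp
  also have "\<dots> \<le> (\<Sum>k<m. sum F {k * q..<k * q + q})"
    by (intro sum_mono block)
  also have "\<dots> = sum F {..<m * q}" by (rule sum.nat_group)
  finally show ?thesis unfolding F_def .
qed

context kl_innovations
begin

text \<open>Assouad's argument: patterns are paired by flipping one block, each pair obeys the
  two-point bound, and the worst pattern does at least as badly as the average.\<close>

lemma max_risk_lower: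
  assumes d: "d \<ge> 1" and "T \<ge> 1" and q: "q \<ge> 6" and mq: "m * q \<le> T"
    and h: "0 \<le> h" "h \<le> \<delta>" and "\<delta> < 1" and "N > 0"
    and "\<eta> > 0" and ball: "\<And>y. emeasure \<psi> {u. \<bar>y + u\<bar> \<le> \<eta>} \<le> ennreal (1/2)"
    and D: "\<kappa> * (real q * h\<^sup>2 * (1 / (1 - \<delta>\<^sup>2))) \<le> D" "0 \<le> D"
    and g: "g \<in> predictors T"
    and cls: "\<And>S. ((\<lambda>u j. if j = 1 then bump_coeff N h (real T / real q) S u else 0), \<lambda>_. 1) \<in> tvar_class d \<beta> R \<delta> \<rho> 1"
  defines "c0 \<equiv> exp (- (4 * (D + 1))) * \<eta>\<^sup>2 / 8"
  shows "ereal (c0 * (real m * (real q / 8) * (h\<^sup>2 * (1/64) ^ N)) / 2 / real T) \<le> max_risk d T g \<psi> \<beta> R \<delta> \<rho> 1"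
proof -
  define \<phi> where "\<phi> = bump_coeff N h (real T / real q)"
  define a where "a S t = \<phi> S (real_of_int (t - 1) / real T)" for S t
  define b where "b r = h * poly (bump_poly N) (real (r mod q) / real q)" for r
  \<comment> \<open>Only complete blocks within the \<open>T\<close> times are switched; nonnegative
    indices keep the coefficient 0 at \<open>t \<le> 0\<close>.\<close>
  define I where "I = {0..<int m}"
  define e where "e S t = (\<integral>\<^sup>+w. ennreal ((g t (\<lambda>s\<in>{..t-1}. ar (a S) w s) - a S t * ar (a S) w (t - 1))\<^sup>2) \<partial>P)"
    for S t
  define A where "A S = (\<Sum>t\<in>{1..int T}. e S t)" for S
  have c0: "0 \<le> c0" by (simp add: c0_def)
  have \<phi>0: "\<phi> S u = 0" if "u \<le> 0" "S \<subseteq> I" for S u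
    unfolding \<phi>_def using that q \<open>N > 0\<close> \<open>T \<ge> 1\<close> by (intro bump_coeff_nonpos) (auto simp: I_def)
  have \<phi>1: "\<bar>\<phi> S u\<bar> \<le> \<delta>" for S u
    using bump_coeff_bounds[OF h(1), of N "real T / real q" S u] h(2) unfolding \<phi>_def by simp
  have a0: "a S t = 0" if "t \<le> 0" "S \<subseteq> I" for S t
    unfolding a_def using that \<open>T \<ge> 1\<close> by (intro \<phi>0) (auto simp: divide_le_0_iff)
  have a_grid: "a S t = (if (t - 1) div int q \<in> S then h * poly (bump_poly N) (real_of_int ((t - 1) mod int q) / real q) else 0)"
    for S t
    unfolding a_def \<phi>_def using q \<open>T \<ge> 1\<close> by (intro bump_coeff_grid) auto
  have d1: "\<delta>\<^sup>2 < 1" using h \<open>\<delta> < 1\<close> by (simp add: abs_square_less_1)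

  \<comment> \<open>Index \<open>r\<close> stands for time \<open>r + 1\<close>, whose coefficient
    is read at \<open>r / T\<close>; hence its block is \<open>r div q\<close>.\<close>
  have pair: "ennreal (c0 * (b r)\<^sup>2) \<le> e S (int (Suc r)) + e S' (int (Suc r))"
    if S: "S \<subseteq> I" "S' \<subseteq> I" and diff: "sym_diff S S' = {int (r div q)}" and r: "r < m * q" for S S' r
  proof -
    define k where "k = int (r div q)"
    have in_iff: "(x \<in> S) = (x \<in> S')" if "x \<noteq> k" for x using diff that unfolding k_def by auto
    have k_iff: "(k \<in> S) = (k \<notin> S')" using diff unfolding k_def by auto
    have bnd: "(a S t - a S' t)\<^sup>2 \<le> h\<^sup>2" for t
    proof -
      have "\<bar>a S t - a S' t\<bar> \<le> h"
        unfolding a_def \<phi>_def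
        using bump_coeff_bounds[OF h(1), of N "real T / real q" S "real_of_int (t - 1) / real T"]
          bump_coeff_bounds[OF h(1), of N "real T / real q" S' "real_of_int (t - 1) / real T"]
        by (intro abs_leI) linarith+
      then have "\<bar>a S t - a S' t\<bar>\<^sup>2 \<le> h\<^sup>2" by (intro power_mono) auto
      then show ?thesis by simp
    qed
    have "(\<Sum>j<T. (a S (int (Suc j)) - a S' (int (Suc j)))\<^sup>2) \<le> real q * h\<^sup>2"
      by (rule sum_block_bound[where k = k]) (use q bnd in_iff in \<open>auto simp: a_grid\<close>)
    then have "\<kappa> * (\<Sum>j<T. (a S (int (Suc j)) - a S' (int (Suc j)))\<^sup>2 * (1 / (1 - \<delta>\<^sup>2)))
        \<le> \<kappa> * (real q * h\<^sup>2 * (1 / (1 - \<delta>\<^sup>2)))"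
      unfolding sum_distrib_right[symmetric] using \<kappa>_nonneg d1
      by (intro mult_left_mono mult_right_mono) auto
    also note D(1)
    finally have D': "\<kappa> * (\<Sum>j<T. (a S (int (Suc j)) - a S' (int (Suc j)))\<^sup>2 * (1 / (1 - \<delta>\<^sup>2))) \<le> D" .
    have rT: "r < T" using r mq by simp
    have "ennreal (c0 * (a S (int (Suc r)) - a S' (int (Suc r)))\<^sup>2) \<le> e S (int (Suc r)) + e S' (int (Suc r))"
      unfolding c0_def e_def
    proof (rule two_point_bound[where \<delta> = \<delta> and n = T])
      show "g (int (Suc r)) \<in> borel_measurable (\<Pi>\<^sub>M s\<in>{..int (Suc r) - 1}. borel)"
        using g rT unfolding predictors_def mem_Collect_eq by (elim bspec) simp
    qed (use a0 S \<phi>1 \<open>\<delta> < 1\<close> \<open>\<eta> > 0\<close> ball D' D(2) rT in \<open>auto simp: a_def\<close>)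
    moreover have "(int (Suc r) - 1) div int q = k" "(int (Suc r) - 1) mod int q = int (r mod q)"
      by (simp_all add: k_def zdiv_int zmod_int)
    then have "(a S (int (Suc r)) - a S' (int (Suc r)))\<^sup>2 = (b r)\<^sup>2"
      using k_iff unfolding a_grid b_def by (simp only: of_int_of_nat_eq) auto
    ultimately show ?thesis by simp
  qed

  have fin: "finite (Pow I)" by (simp add: I_def)
  have card: "card (Pow I) = 2 ^ m" by (simp add: I_def card_Pow)
  \<comment> \<open>Flipping block \<open>k\<close> is an involution of the patterns, so summing
    over pairs counts each pattern twice.\<close>
  have avg: "2 ^ m * ennreal (c0 * (b r)\<^sup>2) \<le> 2 * (\<Sum>S\<in>Pow I. e S (int (Suc r)))" if r: "r < m * q" for r
  proof -
    define k where "k = int (r div q)"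
    have k: "k \<in> I" using r q by (simp add: k_def I_def less_mult_imp_div_less)
    have "2 ^ m * ennreal (c0 * (b r)\<^sup>2) = (\<Sum>S\<in>Pow I. ennreal (c0 * (b r)\<^sup>2))"
      by (simp add: card)
    also have "\<dots> \<le> (\<Sum>S\<in>Pow I. e S (int (Suc r)) + e (sym_diff S {k}) (int (Suc r)))"
      using k r by (intro sum_mono pair) (auto simp: k_def)
    also have "\<dots> = (\<Sum>S\<in>Pow I. e S (int (Suc r))) + (\<Sum>S\<in>Pow I. e (sym_diff S {k}) (int (Suc r)))"
      by (rule sum.distrib)
    also have "(\<Sum>S\<in>Pow I. e (sym_diff S {k}) (int (Suc r))) = (\<Sum>S\<in>Pow I. e S (int (Suc r)))"
      using k by (intro sum.reindex_bij_witness[of _ "\<lambda>S. sym_diff S {k}" "\<lambda>S. sym_diff S {k}"]) auto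
    finally show ?thesis by (simp add: mult_2)
  qed
  define W where "W = c0 * (\<Sum>r<m * q. (b r)\<^sup>2)"
  have W0: "0 \<le> W" unfolding W_def using c0 by (intro mult_nonneg_nonneg sum_nonneg) auto
  \<comment> \<open>Finitely many patterns have a worst one, on which the supremum over the class
    can be tested.\<close>
  obtain S0 where S0: "S0 \<in> Pow I" "\<And>S. S \<in> Pow I \<Longrightarrow> A S \<le> A S0"
  proof -
    have "Max (A ` Pow I) \<in> A ` Pow I" using fin by (intro Max_in) auto
    then obtain S0 where "S0 \<in> Pow I" "Max (A ` Pow I) = A S0" by auto
    moreover have "A S \<le> Max (A ` Pow I)" if "S \<in> Pow I" for S
      using fin that by (intro Max_ge) auto
    ultimately show thesis by (intro that) auto
  qed
  have "ennreal W = (\<Sum>r<m * q. ennreal (c0 * (b r)\<^sup>2))"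
    unfolding W_def sum_distrib_left using c0 by (subst sum_ennreal) auto
  then have "2 ^ m * ennreal W = (\<Sum>r<m * q. 2 ^ m * ennreal (c0 * (b r)\<^sup>2))"
    by (simp only: sum_distrib_left)
  also have "\<dots> \<le> (\<Sum>r<m * q. 2 * (\<Sum>S\<in>Pow I. e S (int (Suc r))))"
    by (intro sum_mono avg) auto
  also have "\<dots> = 2 * (\<Sum>S\<in>Pow I. \<Sum>r<m * q. e S (int (Suc r)))"
    by (simp add: sum_distrib_left[symmetric] sum.swap[of _ "Pow I"])
  also have "(\<Sum>S\<in>Pow I. \<Sum>r<m * q. e S (int (Suc r))) \<le> (\<Sum>S\<in>Pow I. A S)"
  proof (rule sum_mono)
    fix S
    have "(\<Sum>r<m * q. e S (int (Suc r))) = sum (e S) ((\<lambda>r. int (Suc r)) ` {..<m * q})"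
      by (subst sum.reindex) (auto simp: inj_on_def)
    also have "\<dots> \<le> A S"
      unfolding A_def using mq by (intro sum_mono2) auto
    finally show "(\<Sum>r<m * q. e S (int (Suc r))) \<le> A S" .
  qed
  also have "(\<Sum>S\<in>Pow I. A S) \<le> 2 ^ m * A S0"
    using sum_bounded_above[of "Pow I" A "A S0"] S0(2) card by simp
  finally have main: "2 ^ m * ennreal W \<le> 2 * (2 ^ m * A S0)"
    by (simp add: mult_left_mono)
  \<comment> \<open>An infinite total error is trivial; a finite one allows \<open>2 ^ m\<close> to
    be cancelled in the reals.\<close>
  have WA: "ereal (W / 2) \<le> enn2ereal (A S0)"
  proof (cases "A S0")
    case (real r)
    have "ennreal (2 ^ m * W) \<le> ennreal (2 * (2 ^ m * r))"
      using main real W0 by (simp add: ennreal_mult ennreal_power flip: ennreal_numeral)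
    then have "2 ^ m * W \<le> 2 * (2 ^ m * r)"
      using real by (subst (asm) ennreal_le_iff) auto
    then show ?thesis using real by (simp add: enn2ereal_ennreal)
  qed (simp add: top_ereal_def)

  have pe: "prediction_error d \<psi> T (\<lambda>u j. if j = 1 then \<phi> S0 u else 0) (\<lambda>_. 1) g t - ereal (1\<^sup>2) = enn2ereal (e S0 t)"
    if t: "t \<in> {1..int T}" for t
  proof -
    have "prediction_error d \<psi> T (\<lambda>u j. if j = 1 then \<phi> S0 u else 0) (\<lambda>_. 1) g t = enn2ereal (e S0 t + 1)"
      unfolding e_def a_def using d \<open>T \<ge> 1\<close> \<phi>0 S0(1) \<phi>1 \<open>\<delta> < 1\<close> g t
      by (intro prediction_error_ar) auto
    also have "\<dots> = enn2ereal (e S0 t) + 1" by (simp add: plus_ennreal.rep_eq one_ennreal.rep_eq)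
    finally show ?thesis by (cases "enn2ereal (e S0 t)") (auto simp: one_ereal_def)
  qed
  have "ereal (1 / real T) * ereal (W / 2) \<le> ereal (1 / real T) * enn2ereal (A S0)"
    using WA by (intro ereal_mult_left_mono) auto
  also have "enn2ereal (A S0) = (\<Sum>t\<in>{1..int T}. enn2ereal (e S0 t))"
    unfolding A_def by (rule sum_enn2ereal[symmetric]) simp
  also have "\<dots> = (\<Sum>t\<in>{1..int T}. prediction_error d \<psi> T (\<lambda>u j. if j = 1 then \<phi> S0 u else 0) (\<lambda>_. 1) g t - ereal (1\<^sup>2))"
    by (intro sum.cong refl pe[symmetric])
  also have "ereal (1 / real T) * \<dots> \<le> max_risk d T g \<psi> \<beta> R \<delta> \<rho> 1"
    unfolding max_risk_def \<phi>_def by (rule SUP_upper2[OF cls[of S0]]) simp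
  finally have "ereal (W / 2 / real T) \<le> max_risk d T g \<psi> \<beta> R \<delta> \<rho> 1"
    by (simp add: mult.commute)
  moreover have "c0 * (real m * (real q / 8) * (h\<^sup>2 * (1/64) ^ N)) \<le> W"
    unfolding W_def b_def using c0 sum_bump_lower[OF q h(1)] by (intro mult_left_mono)
  then have "ereal (c0 * (real m * (real q / 8) * (h\<^sup>2 * (1/64) ^ N)) / 2 / real T) \<le> ereal (W / 2 / real T)"
    unfolding ereal_less_eq by (intro divide_right_mono) auto
  ultimately show ?thesis by (rule order_trans[rotated])
qed

end

section \<open>Calibration of block length and bump height\<close>

theorem theorem3p1:
  fixes d :: nat and \<delta> \<beta> R \<rho> :: real and \<psi> :: "real measure" and f :: "real \<Rightarrow> real"
  assumes "d \<ge> 1" and "0 < \<delta>" and "\<delta> < 1" and "\<beta> > 0" and "R > 0" and "0 \<le> \<rho>" and "\<rho> \<le> 1"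
    and "prob_space \<psi>"
    and "integrable \<psi> (\<lambda>x. x)" and "(\<integral>x. x \<partial>\<psi>) = 0"
    and "integrable \<psi> (\<lambda>x. x\<^sup>2)" and "(\<integral>x. x\<^sup>2 \<partial>\<psi>) = 1"
    and "f \<in> borel_measurable borel" and "\<And>u. 0 \<le> f u" and "\<psi> = density lborel (\<lambda>u. ennreal (f u))"
    and "kl_shift_const f < \<infinity>"
  shows "0 < Liminf sequentially
           (\<lambda>T. ereal (real T powr (2 * \<beta> / (1 + 2 * \<beta>))) * reduced_minimax_risk d T \<psi> \<beta> R \<delta> \<rho>)"
proof -
  obtain \<kappa> where \<kappa>: "\<kappa> \<ge> 0" "\<And>c. kl_shift f c \<le> ereal (\<kappa> * c\<^sup>2)"
    using kl_shift_const_finite[OF assms(16)] by blast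
  interpret kl_innovations \<psi> f \<kappa>
    by (intro kl_innovations.intro innovations.intro kl_innovations_axioms.intro assms \<kappa>)
  obtain \<eta> where \<eta>: "\<eta> > 0" "\<And>y. emeasure \<psi> {u. \<bar>y + u\<bar> \<le> \<eta>} \<le> ennreal (1/2)"
    using small_ball by blast
  obtain C N where C: "C > 0" "N > 0"
    "\<And>S h \<mu> R. 0 \<le> h \<Longrightarrow> 0 < \<mu> \<Longrightarrow> C * h * \<mu> powr \<beta> \<le> R \<Longrightarrow>
      (\<lambda>u j. if j = 1 then bump_coeff N h \<mu> S u else 0) \<in> holder_ball d \<beta> R"
    using bump_coeff_holder_ball[OF assms(1,4)] by blast
  define \<gamma> where "\<gamma> = 2 * \<beta> / (1 + 2 * \<beta>)"
  \<comment> \<open>The bound \<open>\<delta>\<close> ensures stability, \<open>R / C\<close>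
    membership in the Hoelder ball.\<close>
  define c where "c = min \<delta> (R / C)"
  \<comment> \<open>Entropy bound for one flip, independent of \<open>T\<close> because
    \<open>q * h\<^sup>2 \<le> c\<^sup>2\<close> below.\<close>
  define D where "D = \<kappa> * (c\<^sup>2 * (1 / (1 - \<delta>\<^sup>2)))"
  define c0 where "c0 = exp (- (4 * (D + 1))) * \<eta>\<^sup>2 / 8"
  \<comment> \<open>32 = 8 * 2 * 2: good indices within a block, complete blocks covering at least
    half of the times, and pairing of patterns.\<close>
  define c1 where "c1 = c0 * (1/64) ^ N / 32"
  have \<gamma>: "0 < \<gamma>" "\<gamma> < 1" using \<open>\<beta> > 0\<close> by (auto simp: \<gamma>_def)
  have \<gamma>_eq: "\<gamma> * (1 + 2 * \<beta>) = 2 * \<beta>" using \<open>\<beta> > 0\<close> by (simp add: \<gamma>_def)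
  have c: "0 < c" "c \<le> \<delta>" "C * c \<le> R"
    using assms(2,5) C(1) by (auto simp: c_def min_def field_simps)
  have d1: "\<delta>\<^sup>2 < 1" using assms(2,3) by (simp add: abs_square_less_1)
  have D0: "0 \<le> D" using \<kappa>(1) d1 by (simp add: D_def)
  have c0: "0 < c0" using \<eta>(1) by (simp add: c0_def)
  then have c1: "0 < c1" by (simp add: c1_def)

  have bound: "ereal (c1 * (c\<^sup>2 * (1/2) powr (2 * \<beta>)))
      \<le> ereal (real T powr \<gamma>) * reduced_minimax_risk d T \<psi> \<beta> R \<delta> \<rho>"
    if T: "real T powr \<gamma> \<ge> 6" "T \<ge> 1" for T
  proof -
    define q where "q = nat \<lfloor>real T powr \<gamma>\<rfloor>"
    define m where "m = T div q"
    define h where "h = c * (real q / real T) powr \<beta>"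
    have q6: "q \<ge> 6" using T(1) by (simp add: q_def le_nat_iff le_floor_iff)
    have rq: "real q \<le> real T powr \<gamma>" "real T powr \<gamma> / 2 \<le> real q"
      using T(1) unfolding q_def by linarith+
    have "real T powr \<gamma> \<le> real T powr 1" using T(2) \<gamma> by (intro powr_mono) auto
    with rq T have "real q \<le> real T" by simp
    then have qT: "q \<le> T" by simp
    have mq: "m * q \<le> T" by (simp add: m_def)
    have "m \<ge> 1" using qT q6 by (simp add: m_def div_greater_zero_iff Suc_le_eq)
    have "T = m * q + T mod q" "T mod q < q" using q6 by (simp_all add: m_def)
    moreover have "q \<le> m * q" using \<open>m \<ge> 1\<close> by simp
    \<comment> \<open>The incomplete last block is shorter than \<open>q\<close>, which is itself at
      most \<open>m * q\<close>.\<close>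
    ultimately have "T \<le> 2 * (m * q)" by linarith
    then have mq2: "real T \<le> 2 * (real m * real q)" by (metis of_nat_le_iff of_nat_mult of_nat_numeral)
    have ratio: "0 < real q / real T" "real q / real T \<le> 1" using q6 qT T(2) by auto
    have h0: "0 \<le> h" using c by (simp add: h_def)
    have "(real q / real T) powr \<beta> \<le> 1" using ratio \<open>\<beta> > 0\<close> by (intro powr_le1) auto
    then have "h \<le> c" using c by (simp add: h_def mult_left_le)
    then have hd: "h \<le> \<delta>" using c(2) by simp
    have h2: "h\<^sup>2 = c\<^sup>2 * (real q / real T) powr (2 * \<beta>)"
    proof -
      have "((real q / real T) powr \<beta>)\<^sup>2 = (real q / real T) powr (2 * \<beta>)"
        unfolding power2_eq_square mult_2 by (rule powr_add[symmetric])
      then show ?thesis by (simp add: h_def power_mult_distrib)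
    qed
    \<comment> \<open>The balance that determines \<open>\<gamma>\<close>:
      \<open>q * h\<^sup>2\<close> stays bounded when \<open>q powr (1 + 2 * \<beta>)\<close> is at
      most \<open>T powr (2 * \<beta>)\<close>.\<close>
    have "real q powr (1 + 2 * \<beta>) \<le> (real T powr \<gamma>) powr (1 + 2 * \<beta>)"
      using rq \<open>\<beta> > 0\<close> by (intro powr_mono2) auto
    also have "\<dots> = real T powr (2 * \<beta>)" by (simp add: powr_powr \<gamma>_eq)
    finally have "real q * (real q / real T) powr (2 * \<beta>) \<le> 1"
      using q6 T(2) by (simp add: powr_divide powr_add)
    then have "real q * h\<^sup>2 \<le> c\<^sup>2"
      using c mult_left_mono[of "real q * (real q / real T) powr (2 * \<beta>)" 1 "c\<^sup>2"] by (simp add: h2 mult_ac)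
    then have D: "\<kappa> * (real q * h\<^sup>2 * (1 / (1 - \<delta>\<^sup>2))) \<le> D"
      unfolding D_def using \<kappa>(1) d1 by (intro mult_left_mono mult_right_mono) auto
    have "(real T / real q) powr \<beta> * (real q / real T) powr \<beta> = 1"
      using q6 T(2) by (simp add: powr_mult[symmetric])
    then have CR: "C * h * (real T / real q) powr \<beta> \<le> R"
      using c(3) by (simp add: h_def mult_ac)
    have cls: "((\<lambda>u j. if j = 1 then bump_coeff N h (real T / real q) S u else 0), \<lambda>_. 1) \<in> tvar_class d \<beta> R \<delta> \<rho> 1" for S
    proof -
      have "(\<lambda>u j. if j = 1 then bump_coeff N h (real T / real q) S u else 0) \<in> holder_ball d \<beta> R"
        using h0 q6 T(2) CR by (intro C(3)) auto
      moreover have "\<bar>bump_coeff N h (real T / real q) S u\<bar> \<le> \<delta>" for u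
        using bump_coeff_bounds[OF h0, of N "real T / real q" S u] hd by simp
      then have "(\<lambda>u j. if j = 1 then bump_coeff N h (real T / real q) S u else 0) \<in> stable_class d \<delta>"
        by (intro stable_class_order_one assms) auto
      ultimately show ?thesis using assms(6,7) by (simp add: tvar_class_def)
    qed
    have "ereal (c1 * h\<^sup>2) \<le> reduced_minimax_risk d T \<psi> \<beta> R \<delta> \<rho>"
      unfolding reduced_minimax_risk_def
    proof (rule INF_greatest)
      fix g assume g: "g \<in> predictors T"
      have "c1 * h\<^sup>2 = c0 * (real T / 2 * (1/8) * (h\<^sup>2 * (1/64) ^ N)) / 2 / real T"
        using T(2) by (simp add: c1_def field_simps)
      also have "\<dots> \<le> c0 * (real m * (real q / 8) * (h\<^sup>2 * (1/64) ^ N)) / 2 / real T"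
        using mq2 c0 by (intro divide_right_mono mult_left_mono mult_right_mono) auto
      finally have "ereal (c1 * h\<^sup>2) \<le> ereal (c0 * (real m * (real q / 8) * (h\<^sup>2 * (1/64) ^ N)) / 2 / real T)"
        by simp
      also have "\<dots> \<le> max_risk d T g \<psi> \<beta> R \<delta> \<rho> 1"
        unfolding c0_def
        by (rule max_risk_lower[OF assms(1) T(2) q6 mq h0 hd assms(3) C(2) \<eta> D D0 g cls])
      finally show "ereal (c1 * h\<^sup>2) \<le> max_risk d T g \<psi> \<beta> R \<delta> \<rho> 1" .
    qed
    then have "ereal (real T powr \<gamma>) * ereal (c1 * h\<^sup>2)
        \<le> ereal (real T powr \<gamma>) * reduced_minimax_risk d T \<psi> \<beta> R \<delta> \<rho>"
      by (intro ereal_mult_left_mono) auto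
    moreover have "c1 * (c\<^sup>2 * (1/2) powr (2 * \<beta>)) \<le> real T powr \<gamma> * (c1 * h\<^sup>2)"
    proof -
      \<comment> \<open>Conversely, block length \<open>T powr \<gamma>\<close> would make the
        product with the squared height ratio exactly 1; rounding down to \<open>q\<close> loses at
        most a factor 2 in the length.\<close>
      have "(1/2) powr (2 * \<beta>) = real T powr \<gamma> * (real T powr \<gamma> / 2 / real T) powr (2 * \<beta>)"
      proof -
        have "\<gamma> + \<gamma> * (2 * \<beta>) = 2 * \<beta>" using \<gamma>_eq by (simp add: algebra_simps)
        then have "real T powr \<gamma> * (real T powr \<gamma>) powr (2 * \<beta>) = real T powr (2 * \<beta>)"
          by (simp add: powr_powr powr_add[symmetric])
        then show ?thesis using T(2) by (simp add: powr_divide powr_mult field_simps)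
      qed
      also have "\<dots> \<le> real T powr \<gamma> * (real q / real T) powr (2 * \<beta>)"
        using rq(2) \<open>\<beta> > 0\<close> by (intro mult_left_mono powr_mono2 divide_right_mono) auto
      finally have "(c1 * c\<^sup>2) * (1/2) powr (2 * \<beta>) \<le> (c1 * c\<^sup>2) * (real T powr \<gamma> * (real q / real T) powr (2 * \<beta>))"
        using c1 by (intro mult_left_mono) auto
      then show ?thesis by (simp add: h2 mult_ac)
    qed
    then have "ereal (c1 * (c\<^sup>2 * (1/2) powr (2 * \<beta>))) \<le> ereal (real T powr \<gamma>) * ereal (c1 * h\<^sup>2)"
      by simp
    ultimately show ?thesis by (rule order_trans[rotated])
  qed

  have "\<forall>\<^sub>F T in sequentially. 6 \<le> real T powr \<gamma>"
    using eventually_ge_at_top[of "nat \<lceil>6 powr (1 / \<gamma>)\<rceil>"]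
  proof eventually_elim
    case (elim T)
    have "6 = (6 powr (1 / \<gamma>)) powr \<gamma>" using \<gamma>(1) by (simp add: powr_powr)
    also have "\<dots> \<le> real T powr \<gamma>"
      using elim \<gamma>(1) by (intro powr_mono2) (auto simp: nat_le_iff ceiling_le_iff)
    finally show ?case .
  qed
  then have "\<forall>\<^sub>F T in sequentially. ereal (c1 * (c\<^sup>2 * (1/2) powr (2 * \<beta>)))
      \<le> ereal (real T powr \<gamma>) * reduced_minimax_risk d T \<psi> \<beta> R \<delta> \<rho>"
    using eventually_ge_at_top[of 1] by eventually_elim (rule bound)
  then have "ereal (c1 * (c\<^sup>2 * (1/2) powr (2 * \<beta>))) \<le> Liminf sequentially
      (\<lambda>T. ereal (real T powr \<gamma>) * reduced_minimax_risk d T \<psi> \<beta> R \<delta> \<rho>)"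
    by (rule Liminf_bounded)
  moreover have "0 < ereal (c1 * (c\<^sup>2 * (1/2) powr (2 * \<beta>)))"
    using c1 c by simp
  ultimately show ?thesis unfolding \<gamma>_def by (rule less_le_trans[rotated])
qed

end
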